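(* Let $L/K$ be a finite extension of number fields and $\xi\in W_{O_K}(O_L)$. The following four conditions are equivalent: (1) $\xi$ is integral over $O_K$; (2) the set of coefficients $C_\xi=\{\xi_\mathfrak{a}\in O_L\mid\mathfrak{a}\in I_K\}$ is finite; (3) the orbit $I_K\xi=\{\psi_\mathfrak{a}\xi\mid\mathfrak{a}\in I_K\}\subseteq W_{O_K}(O_L)$ is finite; (4) $\xi$ is automatic.
   Context: For a number field $K$, $O_K$ is its ring of integers, $P_K$ the set of nonzero prime ideals, $I_K$ the monoid of nonzero ideals of $O_K$, $k_\mathfrak{p}=O_K/\mathfrak{p}$ with cardinality $\#k_\mathfrak{p}$. For a flat $O_K$-algebra $A$, $A^{I_K}$ is the product ring with componentwise $O_K$-algebra structure (so $O_K$ sits inside as constant vectors), $\psi_\mathfrak{p}$ the shift $(\xi_\mathfrak{a})_\mathfrak{a}\mapsto(\xi_{\mathfrak{p}\mathfrak{a}})_\mathfrak{a}$, and $\psi_\mathfrak{a}=\psi_{\mathfrak{p}_1}\circ\cdots\circ\psi_{\mathfrak{p}_n}$ for $\mathfrak{a}=\mathfrak{p}_1\cdots\mathfrak{p}_n$, so $(\psi_\mathfrak{a}\xi)_\mathfrak{b}=\xi_{\mathfrak{a}\mathfrak{b}}$. Witt vectors: $U_0(A)=A^{I_K}$, $U_{n+1}(A)=\{\xi\in U_n(A)\mid\psi_\mathfrak{p}\xi-\xi^{\#k_\mathfrak{p}}\in\mathfrak{p}U_n(A)\ \forall\mathfrak{p}\in P_K\}$ ($\mathfrak{p}U_n(A)$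 the $O_K$-submodule generated by $r\zeta$, $r\in\mathfrak{p}$, $\zeta\in U_n(A)$), $W_{O_K}(A)=\bigcap_nU_n(A)$. Automatic: a DFAO over input alphabet $P_K$ and output set $A$ is $(S,\delta,s_0,\tau)$ with $S$ finite, $\delta:S\times P_K\to S$ (extended to finite words by $\delta(s,\varepsilon)=s$, $\delta(s,u\mathfrak{p})=\delta(\delta(s,u),\mathfrak{p})$), $s_0\in S$, $\tau:S\to A$; $\xi$ is automatic if some DFAO satisfies $\xi_\mathfrak{a}=\tau(\delta(s_0,\mathfrak{p}_1\cdots\mathfrak{p}_r))$ for every finite word $\mathfrak{p}_1\cdots\mathfrak{p}_r$ over $P_K$ with $\mathfrak{a}=\mathfrak{p}_1\cdots\mathfrak{p}_r$. *)

theory Defs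
  imports
    "HOL-Computational_Algebra.Polynomial"
    "HOL-Algebra.Algebra"
begin

text \<open>
  Number fields are subfields of an ambient field type of characteristic 0, so that an
  extension \<open>L/K\<close> is an inclusion \<open>K \<subseteq> L\<close>. Rings of integers are turned into records of
  the HOL-Algebra library, whose ideals, prime ideals, ideal products and quotients are used.
\<close>

definition ambient_ring :: "'a::field ring" where
  "ambient_ring = \<lparr>carrier = UNIV, monoid.mult = (*), one = 1, ring.zero = 0, add = (+)\<rparr>"

definition number_field :: "'a::field_char_0 set \<Rightarrow> bool" where
  "number_field K \<longleftrightarrow> subfield K ambient_ring \<and> ring.finite_dimension ambient_ring \<rat> K"

definition finite_extension_of_number_fields :: "'a::field_char_0 set \<Rightarrow> 'a set \<Rightarrow> bool" where
  "finite_extension_of_number_fields K L \<longleftrightarrow>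
     number_field K \<and> number_field L \<and> K \<subseteq> L \<and> ring.finite_dimension ambient_ring K L"

definition ring_of_integers :: "'a::field_char_0 set \<Rightarrow> 'a ring" where
  "ring_of_integers K =
     \<lparr>carrier = {x \<in> K. algebraic_int x}, monoid.mult = (*), one = 1, ring.zero = 0, add = (+)\<rparr>"

text \<open>
  The same ring as an algebra over any ring of integers contained in it.
\<close>

definition algebra_of_integers :: "'a::field_char_0 set \<Rightarrow> ('a, 'a) module" where
  "algebra_of_integers L =
     \<lparr>carrier = {x \<in> L. algebraic_int x}, monoid.mult = (*), one = 1, ring.zero = 0, add = (+),
      module.smult = (*)\<rparr>"

definition nonzero_ideals :: "('r, 'm) ring_scheme \<Rightarrow> 'r set set" where
  "nonzero_ideals R = {I. ideal I R \<and> I \<noteq> {\<zero>\<^bsub>R\<^esub>}}"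

definition nonzero_primes :: "('r, 'm) ring_scheme \<Rightarrow> 'r set set" where
  "nonzero_primes R = {P. primeideal P R \<and> P \<noteq> {\<zero>\<^bsub>R\<^esub>}}"

definition residue_card :: "('r, 'm) ring_scheme \<Rightarrow> 'r set \<Rightarrow> nat" where
  "residue_card R P = card (carrier (R Quot P))"

text \<open>
  The algebra of vectors indexed by the nonzero ideals of \<open>R\<close>, with componentwise structure.
  Vectors are extensional functions, so equality of vectors is equality at all nonzero ideals.
\<close>

definition ghost_algebra ::
    "('r, 'm) ring_scheme \<Rightarrow> ('r, 'a) module \<Rightarrow> ('r, 'r set \<Rightarrow> 'a) module" where
  "ghost_algebra R A =
     \<lparr>carrier = nonzero_ideals R \<rightarrow>\<^sub>E carrier A,
      monoid.mult = (\<lambda>\<xi> \<eta>. \<lambda>I\<in>nonzero_ideals R. \<xi> I \<otimes>\<^bsub>A\<^esub> \<eta> I),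
      one = (\<lambda>I\<in>nonzero_ideals R. \<one>\<^bsub>A\<^esub>),
      ring.zero = (\<lambda>I\<in>nonzero_ideals R. \<zero>\<^bsub>A\<^esub>),
      add = (\<lambda>\<xi> \<eta>. \<lambda>I\<in>nonzero_ideals R. \<xi> I \<oplus>\<^bsub>A\<^esub> \<eta> I),
      module.smult = (\<lambda>r \<xi>. \<lambda>I\<in>nonzero_ideals R. r \<odot>\<^bsub>A\<^esub> \<xi> I)\<rparr>"

definition shift :: "('r, 'm) ring_scheme \<Rightarrow> 'r set \<Rightarrow> ('r set \<Rightarrow> 'a) \<Rightarrow> 'r set \<Rightarrow> 'a" where
  "shift R I \<xi> = (\<lambda>J\<in>nonzero_ideals R. \<xi> (ideal_prod R I J))"

definition submodule_generated ::
    "('r, 'm) ring_scheme \<Rightarrow> ('r, 'a) module \<Rightarrow> 'a set \<Rightarrow> 'a set" where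
  "submodule_generated R M G = \<Inter>{N. submodule N R M \<and> G \<subseteq> N}"

definition ideal_smult ::
    "('r, 'm) ring_scheme \<Rightarrow> ('r, 'a) module \<Rightarrow> 'r set \<Rightarrow> 'a set \<Rightarrow> 'a set" where
  "ideal_smult R M P N = submodule_generated R M {r \<odot>\<^bsub>M\<^esub> \<zeta> | r \<zeta>. r \<in> P \<and> \<zeta> \<in> N}"

primrec witt_stage ::
    "('r, 'm) ring_scheme \<Rightarrow> ('r, 'a) module \<Rightarrow> nat \<Rightarrow> ('r set \<Rightarrow> 'a) set" where
  "witt_stage R A 0 = carrier (ghost_algebra R A)"
| "witt_stage R A (Suc n) =
     {\<xi> \<in> witt_stage R A n. \<forall>P\<in>nonzero_primes R.
        shift R P \<xi> \<ominus>\<^bsub>ghost_algebra R A\<^esub> (\<xi> [^]\<^bsub>ghost_algebra R A\<^esub> residue_card R P)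
          \<in> ideal_smult R (ghost_algebra R A) P (witt_stage R A n)}"

definition witt_vectors ::
    "('r, 'm) ring_scheme \<Rightarrow> ('r, 'a) module \<Rightarrow> ('r set \<Rightarrow> 'a) set" where
  "witt_vectors R A = (\<Inter>n. witt_stage R A n)"

text \<open>
  \<open>x\<close> satisfies a monic equation \<open>x\<^sup>n + c\<^sub>n\<^sub>-\<^sub>1 x\<^sup>n\<^sup>-\<^sup>1 + \<dots> + c\<^sub>0 = 0\<close> over \<open>R\<close>.
\<close>

definition integral_over :: "('r, 'm) ring_scheme \<Rightarrow> ('r, 'a) module \<Rightarrow> 'a \<Rightarrow> bool" where
  "integral_over R M x \<longleftrightarrow>
     (\<exists>(n::nat) c. (\<forall>i<n. c i \<in> carrier R) \<and>
        x [^]\<^bsub>M\<^esub> n \<oplus>\<^bsub>M\<^esub> (\<Oplus>\<^bsub>M\<^esub>i\<in>{..<n}. c i \<odot>\<^bsub>M\<^esub> (x [^]\<^bsub>M\<^esub> i)) = \<zero>\<^bsub>M\<^esub>)"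

definition coefficients :: "('r, 'm) ring_scheme \<Rightarrow> ('r set \<Rightarrow> 'a) \<Rightarrow> 'a set" where
  "coefficients R \<xi> = {\<xi> I | I. I \<in> nonzero_ideals R}"

definition shift_orbit :: "('r, 'm) ring_scheme \<Rightarrow> ('r set \<Rightarrow> 'a) \<Rightarrow> ('r set \<Rightarrow> 'a) set" where
  "shift_orbit R \<xi> = {shift R I \<xi> | I. I \<in> nonzero_ideals R}"

text \<open>
  Since the state set is finite, states may be taken to be natural numbers.
\<close>

definition dfao ::
    "'i set \<Rightarrow> 'o set \<Rightarrow> nat set \<Rightarrow> (nat \<Rightarrow> 'i \<Rightarrow> nat) \<Rightarrow> nat \<Rightarrow> (nat \<Rightarrow> 'o) \<Rightarrow> bool" where
  "dfao \<Sigma> \<Delta> S \<delta> s\<^sub>0 \<tau> \<longleftrightarrow>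
     finite S \<and> (\<forall>s\<in>S. \<forall>p\<in>\<Sigma>. \<delta> s p \<in> S) \<and> s\<^sub>0 \<in> S \<and> (\<forall>s\<in>S. \<tau> s \<in> \<Delta>)"

definition ideal_word_prod :: "('r, 'm) ring_scheme \<Rightarrow> 'r set list \<Rightarrow> 'r set" where
  "ideal_word_prod R w = foldr (ideal_prod R) w (carrier R)"

definition automatic ::
    "('r, 'm) ring_scheme \<Rightarrow> ('r, 'a) module \<Rightarrow> ('r set \<Rightarrow> 'a) \<Rightarrow> bool" where
  "automatic R A \<xi> \<longleftrightarrow>
     (\<exists>S \<delta> s\<^sub>0 \<tau>. dfao (nonzero_primes R) (carrier A) S \<delta> s\<^sub>0 \<tau> \<and>
        (\<forall>w\<in>lists (nonzero_primes R). \<xi> (ideal_word_prod R w) = \<tau> (foldl \<delta> s\<^sub>0 w)))"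

end

theory Submission
  imports Defs "Jordan_Normal_Form.Char_Poly"
begin

text \<open>
  The heart is that finitely many coefficients force a finite orbit. A prime \<open>P\<close> that separates the
  coefficients acts through the congruence \<open>\<xi> (P I) \<equiv> (\<xi> I)\<^sup>q\<close> modulo \<open>P\<close>: the value \<open>\<xi> (P I)\<close> depends only
  on \<open>\<xi> I\<close>, so such shifts never distinguish ideals that \<open>\<xi>\<close> does not distinguish. For each of the
  finitely many other primes, induction on \<open>j\<close> shows that all \<open>P\<close>-power shifts of an element of the
  \<open>j\<close>-th stage are, modulo the \<open>j\<close>-th power of \<open>P\<close>, constant on the parts of a common finite partition
  of the ideals, because \<open>\<zeta> \<mapsto> \<zeta>\<^sup>q + \<eta>\<close> acts componentwise on a finite residue ring; for large \<open>j\<close> the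
  coefficients are distinct modulo that power. Shifts commute, so the orbit under all primes is
  finite. Unique factorization is only needed in the form that every nonzero ideal is a product of
  primes. An integral \<open>\<xi>\<close> has all its coefficients among the roots of one polynomial; conversely,
  finitely many algebraic integers are roots of a common monic integer polynomial.
\<close>

section \<open>Algebraic integers form a ring\<close>

text \<open>There are infinitely many primes, so separate finite partitions, one for each prime,
  would not combine into a finite one. This is why the separating primes are treated by a congruence
  that needs no partition; only finitely many primes are left, because each of these contains one of
  finitely many positive integers. For them the congruence modulo \<open>P\<close> loses
  information, and the exponent that separates the coefficients depends on \<xi>, hence the use of
  all stages. Valuations and localizations are avoided: an element \<open>x\<close> of
  \<open>K\<close> with \<open>x P\<close> integral but \<open>x\<close> not integral measures
  divisibility by powers of \<open>P\<close> through the integrality of \<open>x ^ i * y\<close>.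
  Most of the ideal theory is drawn from the finiteness of the residues modulo a positive integer;
  pigeonhole then gives inverses modulo primes, induction along increasing ideals, and the
  integrality of almost integral elements.\<close>

global_interpretation int_module: Modules.module "\<lambda>(n::int) (x::'a::field_char_0). of_int n * x"
  defines int_span = int_module.span
  by standard (simp_all add: algebra_simps)

lemma int_span_mult_left:
  fixes B C :: "'a::field_char_0 set"
  assumes "x \<in> int_span B" and "\<And>b. b \<in> B \<Longrightarrow> y * b \<in> int_span C"
  shows "y * x \<in> int_span C"
  using assms(1)
proof (induction rule: int_module.span_induct_alt)
  case base
  show ?case by (simp add: int_module.span_zero)
next
  case (step c b z)
  have "of_int c * (y * b) + y * z \<in> int_span C"
    by (intro int_module.span_add int_module.span_scale assms(2) step)
  then show ?case by (simp add: algebra_simps)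
qed

text \<open>Determinant trick: \<open>x\<close> acts on the generators through an integer matrix, so
  the vector of generators is an eigenvector, and the characteristic polynomial is monic. The
  nonzero generator keeps this vector from vanishing.\<close>

lemma algebraic_int_if_stabilizes_int_span:
  fixes x :: "'a::field_char_0"
  assumes fin: "finite B" and nz: "b0 \<in> B" "b0 \<noteq> 0"
    and stable: "\<And>b. b \<in> B \<Longrightarrow> x * b \<in> int_span B"
  shows "algebraic_int x"
proof -
  obtain bs where bs: "set bs = B" "distinct bs"
    using fin finite_distinct_list by blast
  define n where "n = length bs"
  have "\<exists>u. x * b = (\<Sum>v\<in>B. of_int (u v) * v)" if "b \<in> B" for b
    using stable[OF that] unfolding int_module.span_finite[OF fin] by auto
  then obtain u where u: "\<And>b. b \<in> B \<Longrightarrow> x * b = (\<Sum>v\<in>B. of_int (u b v) * v)"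
    by metis
  define A :: "int mat" where "A = mat n n (\<lambda>(i, j). u (bs ! i) (bs ! j))"
  define A' :: "'a mat" where "A' = map_mat of_int A"
  define w where "w = vec n (\<lambda>i. bs ! i)"
  have A: "A \<in> carrier_mat n n" and A': "A' \<in> carrier_mat n n"
    by (simp_all add: A_def A'_def)
  have "A' *\<^sub>v w = x \<cdot>\<^sub>v w"
  proof (rule eq_vecI)
    fix i assume "i < dim_vec (x \<cdot>\<^sub>v w)"
    then have i: "i < n" by (simp add: w_def)
    have "(A' *\<^sub>v w) $ i = (\<Sum>j<n. of_int (u (bs ! i) (bs ! j)) * bs ! j)"
      using i by (simp add: A'_def A_def w_def scalar_prod_def atLeast0LessThan)
    also have "\<dots> = (\<Sum>v\<in>B. of_int (u (bs ! i) v) * v)"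
      unfolding bs(1)[symmetric] n_def
      by (rule sum.reindex_bij_betw, rule bij_betw_nth) (simp_all add: bs)
    also have "\<dots> = x * bs ! i"
      using u[of "bs ! i"] i bs(1) nth_mem[of i bs] by (simp add: n_def)
    finally show "(A' *\<^sub>v w) $ i = (x \<cdot>\<^sub>v w) $ i" using i by (simp add: w_def)
  qed (use A' in \<open>simp add: w_def\<close>)
  moreover have "w \<noteq> 0\<^sub>v n"
  proof
    assume w: "w = 0\<^sub>v n"
    obtain i where "i < n" "bs ! i = b0"
      using nz(1) bs(1) unfolding n_def in_set_conv_nth[symmetric] by (metis in_set_conv_nth)
    then show False using nz(2) arg_cong[OF w, of "\<lambda>v. v $ i"] by (simp add: w_def)
  qed
  ultimately have "eigenvalue A' x"
    unfolding eigenvalue_def eigenvector_def using A'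
    by (intro exI[of _ w]) (auto simp: w_def)
  then have "poly (char_poly A') x = 0"
    using eigenvalue_root_char_poly[OF A'] by simp
  then have "poly (map_poly of_int (char_poly A)) x = 0"
    using of_int_hom.char_poly_hom[OF A, where ?'a = 'a] by (simp add: A'_def)
  moreover have "Polynomial.coeff (char_poly A) (Polynomial.degree (char_poly A)) = 1"
    using degree_monic_char_poly[OF A] by simp
  ultimately show ?thesis
    unfolding algebraic_int_altdef_ipoly by blast
qed

text \<open>A subring that is finitely generated as an abelian group. Finitely many algebraic
  integers lie in a common one, which gives closure under sums and products.\<close>

definition int_order :: "'a::field_char_0 set \<Rightarrow> bool" where
  "int_order R \<longleftrightarrow> (\<exists>B. finite B \<and> R = int_span B) \<and> 1 \<in> R \<and> (\<forall>x\<in>R. \<forall>y\<in>R. x * y \<in> R)"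

lemma int_order_algebraic_int:
  assumes "int_order R" "x \<in> R"
  shows "algebraic_int x"
proof -
  obtain B where B: "finite B" "R = int_span B"
    using assms(1) unfolding int_order_def by blast
  have one: "1 \<in> R" and mult: "\<And>y. y \<in> R \<Longrightarrow> x * y \<in> R"
    using assms unfolding int_order_def by auto
  have "\<exists>b\<in>B. b \<noteq> 0"
  proof (rule ccontr)
    assume "\<not> ?thesis"
    then have "B \<subseteq> {0}" by auto
    then have "int_span B \<subseteq> int_span {0}" by (rule int_module.span_mono)
    then show False using one B(2) by (auto simp: int_module.span_singleton)
  qed
  then obtain b where "b \<in> B" "b \<noteq> 0" by blast
  then show ?thesis
    using algebraic_int_if_stabilizes_int_span[OF B(1)] mult B(2)
    by (meson int_module.span_base)
qed

lemma int_order_Ints: "int_order (\<int> :: 'a::field_char_0 set)"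
proof -
  have "\<int> = int_span {1::'a}"
    by (auto simp: int_module.span_singleton Ints_def)
  then show ?thesis unfolding int_order_def by (metis Ints_1 Ints_mult finite.simps)
qed

text \<open>The old generators times the powers of \<open>x\<close> below \<open>n\<close> generate
  the larger order, because the equation rewrites every higher power.\<close>

lemma int_order_adjoin:
  fixes x :: "'a::field_char_0"
  assumes R: "int_order R" and eq: "x ^ n = (\<Sum>i<n. a i * x ^ i)" and a: "\<And>i. i < n \<Longrightarrow> a i \<in> R"
  shows "\<exists>S. int_order S \<and> R \<subseteq> S \<and> x \<in> S"
proof -
  obtain B where B: "finite B" "R = int_span B"
    using R unfolding int_order_def by blast
  have one: "1 \<in> R" and mult: "\<And>y z. y \<in> R \<Longrightarrow> z \<in> R \<Longrightarrow> y * z \<in> R"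
    using R unfolding int_order_def by auto
  define C where "C = (\<lambda>(b, i). b * x ^ i) ` (B \<times> {..<n})"
  have low: "x ^ i * r \<in> int_span C" if "r \<in> R" "i < n" for r i
  proof (rule int_span_mult_left)
    show "r \<in> int_span B" using that B(2) by simp
    fix b assume "b \<in> B"
    then show "x ^ i * b \<in> int_span C"
      using that(2) by (intro int_module.span_base) (auto simp: C_def intro!: image_eqI[of _ _ "(b, i)"])
  qed
  \<comment> \<open>The factor \<open>r\<close> stays arbitrary: replacing \<open>x ^ n\<close>
    turns it into the products \<open>r * a j\<close> in front of lower powers.\<close>
  have pow: "r * x ^ i \<in> int_span C" if "r \<in> R" for r i
    using that
  proof (induction i arbitrary: r rule: less_induct)
    case (less i)
    show ?case
    proof (cases "i < n")
      case True
      then show ?thesis using low[OF less.prems] by (simp add: mult.commute)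
    next
      case False
      have "r * x ^ i = r * x ^ (i - n) * x ^ n" using False by (simp flip: power_add)
      also have "\<dots> = (\<Sum>j<n. (r * a j) * x ^ (i - n + j))"
        unfolding eq by (simp add: sum_distrib_left power_add mult_ac)
      also have "\<dots> \<in> int_span C"
        by (rule int_module.span_sum) (use False in \<open>auto intro!: less.IH mult less.prems a\<close>)
      finally show ?thesis .
    qed
  qed
  have "y * z \<in> int_span C" if "y \<in> int_span C" "z \<in> int_span C" for y z
  proof (rule int_span_mult_left[OF that(2)])
    fix c assume "c \<in> C"
    then obtain b i where c: "c = b * x ^ i" "b \<in> R"
      using B(2) by (auto simp: C_def int_module.span_base)
    have "c * y \<in> int_span C"
    proof (rule int_span_mult_left[OF that(1)])
      fix d assume "d \<in> C"
      then obtain b' j where d: "d = b' * x ^ j" "b' \<in> R"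
        using B(2) by (auto simp: C_def int_module.span_base)
      show "c * d \<in> int_span C"
        using pow[OF mult[OF c(2) d(2)], of "i + j"] by (simp add: c d power_add mult_ac)
    qed
    then show "y * c \<in> int_span C" by (simp add: mult.commute)
  qed
  moreover have "R \<subseteq> int_span C" using pow[of _ 0] by auto
  moreover have "x \<in> int_span C" using pow[OF one, of 1] by simp
  moreover have "finite C" using B(1) by (simp add: C_def)
  ultimately show ?thesis
    using one by (intro exI[of _ "int_span C"]) (auto simp: int_order_def)
qed

lemma poly_monic_root_eq:
  fixes x :: "'a::comm_ring_1"
  assumes "poly p x = 0" "Polynomial.coeff p (Polynomial.degree p) = 1"
  shows "x ^ Polynomial.degree p = (\<Sum>i<Polynomial.degree p. - Polynomial.coeff p i * x ^ i)"
proof -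
  have "(\<Sum>i\<le>Polynomial.degree p. Polynomial.coeff p i * x ^ i) = 0" using assms(1) by (simp add: poly_altdef)
  then show ?thesis
    using assms(2) by (simp add: lessThan_Suc_atMost[symmetric] sum_negf eq_neg_iff_add_eq_0 add.commute)
qed

lemma algebraic_ints_in_int_order:
  assumes "finite A" "\<And>a. a \<in> A \<Longrightarrow> algebraic_int (a::'a::field_char_0)"
  shows "\<exists>R. int_order R \<and> A \<subseteq> R"
  using assms
proof (induction A)
  case empty
  then show ?case using int_order_Ints by blast
next
  case (insert a A)
  then obtain R where R: "int_order R" "A \<subseteq> R" by auto
  obtain p where p: "Polynomial.coeff p (Polynomial.degree p) = 1" "\<forall>i. Polynomial.coeff p i \<in> \<int>" "poly p a = 0"
    using insert.prems[of a] by (auto elim: algebraic_int.cases)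
  have "\<int> \<subseteq> R"
  proof -
    obtain B where "R = int_span B" "1 \<in> R" using R(1) by (auto simp: int_order_def)
    then show ?thesis
      using int_module.span_scale[of 1 B] by (auto simp: Ints_def)
  qed
  then have "- Polynomial.coeff p i \<in> R" for i
    using p(2) Ints_minus by blast
  from int_order_adjoin[OF R(1) poly_monic_root_eq[OF p(3,1)] this]
  show ?case using R(2) by auto
qed

lemma
  fixes x y :: "'a::field_char_0"
  assumes "algebraic_int x" "algebraic_int y"
  shows algebraic_int_add: "algebraic_int (x + y)"
    and algebraic_int_mult: "algebraic_int (x * y)"
proof -
  obtain R where R: "int_order R" "{x, y} \<subseteq> R"
    using algebraic_ints_in_int_order[of "{x, y}"] assms by auto
  then have "x * y \<in> R" "x + y \<in> R"
    by (auto simp: int_order_def intro: int_module.span_add)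
  then show "algebraic_int (x + y)" "algebraic_int (x * y)"
    using R(1) int_order_algebraic_int by blast+
qed

text \<open>Transitivity of integrality: the coefficients lie in one order, and the equation adjoins
  \<open>x\<close> to it.\<close>

lemma algebraic_int_integral:
  fixes x :: "'a::field_char_0"
  assumes "x ^ n = (\<Sum>i<n. a i * x ^ i)" "\<And>i. i < n \<Longrightarrow> algebraic_int (a i)"
  shows "algebraic_int x"
proof -
  obtain R where R: "int_order R" "a ` {..<n} \<subseteq> R"
    using algebraic_ints_in_int_order[of "a ` {..<n}"] assms(2) by auto
  from int_order_adjoin[OF R(1) assms(1)] R(2) show ?thesis
    using int_order_algebraic_int by (metis image_subset_iff lessThan_iff)
qed

section \<open>Finiteness of the residue rings\<close>

global_interpretation rat_space: Vector_Spaces.vector_space "\<lambda>(q::rat) (x::'a::field_char_0). of_rat q * x"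
  defines rat_span = rat_space.span and rat_dependent = rat_space.dependent
  by standard (simp_all add: algebra_simps of_rat_add of_rat_mult)

lemma ring_ambient_ring: "ring (ambient_ring :: 'a::field ring)"
  by (rule ringI; (rule abelian_groupI; auto simp: ambient_ring_def intro: exI[of _ "- x" for x])?)
     (auto simp: ambient_ring_def algebra_simps intro!: monoidI)

text \<open>Transfers the inductive notion of dimension to rational spans, where a spanning set
  bounds the size of independent sets.\<close>

lemma finite_dimension_imp_rat_span:
  fixes E :: "'a::field_char_0 set"
  assumes "ring.finite_dimension ambient_ring \<rat> E"
  shows "\<exists>B. finite B \<and> E \<subseteq> rat_span B"
proof -
  obtain n where "ring.dimension ambient_ring n \<rat> E"
    using assms unfolding ring.finite_dimension_def[OF ring_ambient_ring] by blast
  then show ?thesis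
  proof (induction n "\<rat> :: 'a set" E rule: ring.dimension.induct[OF ring_ambient_ring, consumes 1])
    case 1
    show ?case
      by (intro exI[of _ "{}"]) (auto simp: ambient_ring_def rat_space.span_empty)
  next
    case (2 v E n)
    then obtain B where B: "finite B" "E \<subseteq> rat_span B" by blast
    have "k * v + e \<in> rat_span (insert v B)" if "k \<in> \<rat>" "e \<in> E" for k e
    proof -
      have "e \<in> rat_span (insert v B)"
        using that B(2) rat_space.span_mono[of B "insert v B"] by auto
      moreover have "k * v \<in> rat_span (insert v B)"
        using that rat_space.span_scale[OF rat_space.span_base[of v "insert v B"]]
        by (auto elim: Rats_cases)
      ultimately show ?thesis by (simp add: rat_space.span_add)
    qed
    then have "ring.line_extension ambient_ring \<rat> v E \<subseteq> rat_span (insert v B)"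
      unfolding ring.line_extension_def[OF ring_ambient_ring]
      by (auto simp: set_add_def' r_coset_def ambient_ring_def)
    then show ?case using B(1) by blast
  qed
qed

lemma ex_common_denominator:
  fixes u :: "'b \<Rightarrow> rat"
  assumes "finite V"
  shows "\<exists>d m. d > 0 \<and> (\<forall>v\<in>V. of_int d * u v = of_int (m v))"
  using assms
proof (induction V)
  case empty
  show ?case by (intro exI[of _ 1]) auto
next
  case (insert x V)
  then obtain d m where d: "d > 0" "\<forall>v\<in>V. of_int d * u v = of_int (m v)" by blast
  obtain a b where ab: "b > 0" "u x = of_int a / of_int b"
    by (cases "u x") (auto simp: Fract_of_int_quotient)
  define m' where "m' = (\<lambda>v. m v * b)(x := d * a)"
  have "of_int (d * b) * u v = of_int (m' v)" if v: "v \<in> insert x V" for v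
  proof (cases "v = x")
    case True
    then show ?thesis using ab by (simp add: m'_def)
  next
    case False
    then have "of_int d * u v = of_int (m v)" using v d(2) by blast
    then show ?thesis using False by (simp add: m'_def mult.assoc mult.left_commute)
  qed
  moreover have "d * b > 0" using d(1) ab(1) by simp
  ultimately show ?case by blast
qed

lemma int_relation_if_rat_dependent:
  assumes "finite V" "rat_dependent V"
  shows "\<exists>u. (\<exists>v\<in>V. u v \<noteq> 0) \<and> (\<Sum>v\<in>V. of_int (u v) * v) = 0"
proof -
  obtain q where q: "\<exists>v\<in>V. q v \<noteq> 0" "(\<Sum>v\<in>V. of_rat (q v) * v) = 0"
    using assms(2) unfolding rat_space.dependent_finite[OF assms(1)] by blast
  obtain d k where d: "d > 0" "\<forall>v\<in>V. of_int d * q v = of_int (k v)"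
    using ex_common_denominator[OF assms(1)] by metis
  have "(\<Sum>v\<in>V. of_int (k v) * v) = (\<Sum>v\<in>V. of_int d * (of_rat (q v) * v))"
  proof (rule sum.cong)
    fix v assume "v \<in> V"
    then have "of_rat (of_int d * q v) = (of_int (k v) :: 'a)" using d(2) by simp
    then show "of_int (k v) * v = of_int d * (of_rat (q v) * v)"
      by (simp add: of_rat_mult mult.assoc[symmetric])
  qed simp
  also have "\<dots> = 0" using q(2) by (simp flip: sum_distrib_left)
  finally have "(\<Sum>v\<in>V. of_int (k v) * v) = 0" .
  moreover obtain v where "v \<in> V" "q v \<noteq> 0" using q(1) by blast
  then have "k v \<noteq> 0" using d \<open>v \<in> V\<close> by force
  ultimately show ?thesis using \<open>v \<in> V\<close> by blast
qed

definition int_ring :: "'a::field_char_0 set \<Rightarrow> 'a set" where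
  "int_ring K = {x \<in> K. algebraic_int x}"

text \<open>A relation with coefficients all divisible by \<open>p\<close> can be divided by \<open>p\<close>, so that independence
  modulo \<open>p\<close> implies independence.\<close>

lemma card_le_if_independent_mod:
  fixes V :: "'a::field_char_0 set" and p :: int
  assumes p: "p > 1" and B: "finite B" "V \<subseteq> rat_span B" and fin: "finite V"
    and ind: "\<And>u. (\<Sum>v\<in>V. of_int (u v) * v) = 0 \<Longrightarrow> \<forall>v\<in>V. p dvd u v"
  shows "card V \<le> card B"
proof -
  have "\<forall>v\<in>V. u v = 0" if "(\<Sum>v\<in>V. of_int (u v) * v) = 0" for u
    using that
  \<comment> \<open>Descent on the total absolute value of the coefficients, which division by
    \<open>p\<close> lowers unless all of them vanish.\<close>
  proof (induction "\<Sum>v\<in>V. nat \<bar>u v\<bar>" arbitrary: u rule: less_induct)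
    case less
    note dv = ind[OF less.prems]
    define w where "w v = u v div p" for v
    have uw: "u v = p * w v" if "v \<in> V" for v
      unfolding w_def using bspec[OF dv that] by (rule dvd_mult_div_cancel[symmetric])
    have "of_int (u v) * v = of_int p * (of_int (w v) * v)" if "v \<in> V" for v
      by (simp only: uw[OF that] of_int_mult mult.assoc)
    then have "of_int p * (\<Sum>v\<in>V. of_int (w v) * v) = (\<Sum>v\<in>V. of_int (u v) * v)"
      by (simp only: sum_distrib_left cong: sum.cong)
    then have w0: "(\<Sum>v\<in>V. of_int (w v) * v) = 0" using p less.prems by simp
    show ?case
    proof (rule ccontr)
      assume "\<not> ?thesis"
      then obtain v where v: "v \<in> V" "u v \<noteq> 0" by blast
      have le: "nat \<bar>w v\<bar> \<le> nat \<bar>u v\<bar>" "w v \<noteq> 0 \<Longrightarrow> nat \<bar>w v\<bar> < nat \<bar>u v\<bar>" if "v \<in> V" for v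
      proof -
        have abs: "\<bar>u v\<bar> = p * \<bar>w v\<bar>" unfolding uw[OF that] abs_mult using p by simp
        show "nat \<bar>w v\<bar> \<le> nat \<bar>u v\<bar>"
          using p mult_right_mono[of 1 p "\<bar>w v\<bar>"] unfolding abs by simp
        show "nat \<bar>w v\<bar> < nat \<bar>u v\<bar>" if "w v \<noteq> 0"
          using p that mult_strict_right_mono[of 1 p "\<bar>w v\<bar>"] unfolding abs by simp
      qed
      have "w v \<noteq> 0" using v uw by auto
      then have "(\<Sum>v\<in>V. nat \<bar>w v\<bar>) < (\<Sum>v\<in>V. nat \<bar>u v\<bar>)"
        using v(1) le by (intro sum_strict_mono_ex1 fin) auto
      from less.hyps[OF this w0] have "w v = 0" using v(1) by blast
      then show False using \<open>w v \<noteq> 0\<close> by simp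
    qed
  qed
  then have "\<not> rat_dependent V"
    using int_relation_if_rat_dependent[OF fin] by blast
  then show ?thesis using rat_space.independent_span_bound[OF B(1)] B(2) by blast
qed

section \<open>Closure properties and residues of the ring of integers\<close>

locale number_field_integers =
  fixes K :: "'a::field_char_0 set"
  assumes number_field: "number_field K"
begin

lemma subfield: "subfield K ambient_ring"
  using number_field by (simp add: number_field_def)

lemma zero_mem: "0 \<in> K" and one_mem: "1 \<in> K"
  and add_mem: "x \<in> K \<Longrightarrow> y \<in> K \<Longrightarrow> x + y \<in> K"
  and mult_mem: "x \<in> K \<Longrightarrow> y \<in> K \<Longrightarrow> x * y \<in> K"
  using subringE[OF subcring.axioms(1)[OF subdomain.axioms(1)[OF subfield.axioms(1)[OF subfield]]]]
  by (simp_all add: ambient_ring_def)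

lemma inverse_mem: assumes "x \<in> K" shows "inverse x \<in> K"
proof (cases "x = 0")
  case False
  have "x \<in> Units (ambient_ring \<lparr>carrier := K\<rparr>)"
    using subfield.subfield_Units[OF subfield] False assms by (simp add: ambient_ring_def)
  then obtain y where "y \<in> K" "x * y = 1" by (auto simp: Units_def ambient_ring_def)
  then show ?thesis using False by (metis inverse_unique)
qed (simp add: zero_mem)

lemma uminus_mem: assumes "x \<in> K" shows "- x \<in> K"
proof -
  have "subring K ambient_ring" using subfield by (simp add: subfield_def subdomain_def subcring_def)
  then have "\<ominus>\<^bsub>ambient_ring\<^esub> x \<in> K" using assms by (rule subringE(5))
  moreover have "\<ominus>\<^bsub>ambient_ring\<^esub> x = - x"
    using abelian_group.minus_equality[OF ring.is_abelian_group[OF ring_ambient_ring], of "- x" x]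
    by (simp add: ambient_ring_def)
  ultimately show ?thesis by simp
qed

lemma of_int_mem: "of_int n \<in> K"
proof -
  have "of_nat m \<in> K" for m by (induction m) (auto simp: zero_mem one_mem add_mem)
  then show ?thesis by (cases n) (use uminus_mem in \<open>auto simp del: of_nat_Suc\<close>)
qed

abbreviation "\<O> \<equiv> int_ring K"

lemma int_ring_imp_mem: "x \<in> \<O> \<Longrightarrow> x \<in> K"
  by (simp add: int_ring_def)

lemma int_ring_0: "0 \<in> \<O>" and int_ring_1: "1 \<in> \<O>" and int_ring_of_int: "of_int n \<in> \<O>"
  and int_ring_add: "x \<in> \<O> \<Longrightarrow> y \<in> \<O> \<Longrightarrow> x + y \<in> \<O>"
  and int_ring_mult: "x \<in> \<O> \<Longrightarrow> y \<in> \<O> \<Longrightarrow> x * y \<in> \<O>"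
  and int_ring_uminus: "x \<in> \<O> \<Longrightarrow> - x \<in> \<O>"
  by (auto simp: int_ring_def zero_mem one_mem of_int_mem add_mem mult_mem uminus_mem
      algebraic_int_add algebraic_int_mult)

lemma int_ring_diff: "x \<in> \<O> \<Longrightarrow> y \<in> \<O> \<Longrightarrow> x - y \<in> \<O>"
  using int_ring_add[OF _ int_ring_uminus] by fastforce

lemma int_ring_power: "x \<in> \<O> \<Longrightarrow> x ^ n \<in> \<O>"
  by (induction n) (auto simp: int_ring_1 int_ring_mult)

lemma int_ring_sum: "(\<And>i. i \<in> I \<Longrightarrow> f i \<in> \<O>) \<Longrightarrow> sum f I \<in> \<O>"
  by (induction I rule: infinite_finite_induct) (auto simp: int_ring_0 int_ring_add)

lemmas int_ring_intros = int_ring_0 int_ring_1 int_ring_of_int int_ring_add int_ring_mult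
  int_ring_uminus int_ring_diff int_ring_power int_ring_sum

text \<open>Modulo \<open>p\<close> the ring is a vector space over the field with \<open>p\<close>
  elements. Sets independent there are independent over the rationals, which bounds their size, so a
  largest one exists and spans; its combinations with digits below \<open>p\<close> represent all
  classes.\<close>

lemma finite_residues_prime:
  fixes p :: int
  assumes p: "normalization_semidom_class.prime p"
  shows "\<exists>S. finite S \<and> S \<subseteq> \<O> \<and> (\<forall>y\<in>\<O>. \<exists>s\<in>S. \<exists>z\<in>\<O>. y = s + of_int p * z)"
proof -
  obtain B where B: "finite B" "K \<subseteq> rat_span B"
    using number_field finite_dimension_imp_rat_span unfolding number_field_def by blast
  define ind where "ind V \<longleftrightarrow> finite V \<and> V \<subseteq> \<O> \<and>
    (\<forall>u. (\<exists>z\<in>\<O>. (\<Sum>v\<in>V. of_int (u v) * v) = of_int p * z) \<longrightarrow> (\<forall>v\<in>V. p dvd u v))" for V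
  have "card V < Suc (card B)" if "ind V" for V
  proof -
    have "card V \<le> card B"
    proof (rule card_le_if_independent_mod[of p])
      show "V \<subseteq> rat_span B" using that B(2) int_ring_imp_mem unfolding ind_def by blast
      fix u assume u: "(\<Sum>v\<in>V. of_int (u v) * v) = 0"
      show "\<forall>v\<in>V. p dvd u v" using that int_ring_0 u unfolding ind_def by (metis mult_zero_right)
    qed (use that p B(1) prime_gt_1_int in \<open>auto simp: ind_def\<close>)
    then show ?thesis by simp
  qed
  moreover have "ind {}" by (simp add: ind_def)
  ultimately obtain V where V: "ind V" and max: "\<And>Y. ind Y \<Longrightarrow> card Y \<le> card V"
    using ex_has_greatest_nat[of ind "{}" card "Suc (card B)"] by auto
  have fin: "finite V" and sub: "V \<subseteq> \<O>" using V by (auto simp: ind_def)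
  define S where "S = (\<lambda>u. \<Sum>v\<in>V. of_int (u v) * v) ` (V \<rightarrow>\<^sub>E {0..<p})"
  have "\<exists>s\<in>S. \<exists>z\<in>\<O>. y = s + of_int p * z" if y: "y \<in> \<O>" for y
  proof -
    have "\<exists>a. \<exists>z\<in>\<O>. y = (\<Sum>v\<in>V. of_int (a v) * v) + of_int p * z"
    proof (cases "y \<in> V")
      case True
      have "y = (\<Sum>v\<in>V. of_int (if v = y then 1 else 0) * v) + of_int p * 0"
        using True fin by (simp add: if_distrib[of of_int] if_distrib[of "\<lambda>c. c * _"] cong: if_cong)
      then show ?thesis using int_ring_0 by (intro exI[of _ "\<lambda>v. if v = y then 1 else 0"]) blast
    next
      case False
      \<comment> \<open>By maximality \<open>y\<close> enters a relation modulo \<open>p\<close>.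
        Its coefficient is prime to \<open>p\<close>, since otherwise its term could be moved into
        \<open>p * z\<close>, leaving a relation on \<open>V\<close>; Bezout then solves for
        \<open>y\<close>.\<close>
      then have "\<not> ind (insert y V)" using max[of "insert y V"] fin by auto
      then obtain u z where u: "z \<in> \<O>" "(\<Sum>v\<in>insert y V. of_int (u v) * v) = of_int p * z"
        "\<not> (\<forall>v\<in>insert y V. p dvd u v)"
        using fin sub y unfolding ind_def by auto
      have eq: "of_int (u y) * y + (\<Sum>v\<in>V. of_int (u v) * v) = of_int p * z"
        using u(2) fin False by simp
      have "\<not> p dvd u y"
      proof
        assume "p dvd u y"
        then obtain c where c: "u y = p * c" by blast
        have "(\<Sum>v\<in>V. of_int (u v) * v) = of_int p * (z - of_int c * y)"
          using eq by (simp add: c algebra_simps)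
        moreover have "z - of_int c * y \<in> \<O>" using u(1) y by (intro int_ring_intros)
        ultimately have "\<forall>v\<in>V. p dvd u v" using V unfolding ind_def by blast
        then show False using u(3) \<open>p dvd u y\<close> by blast
      qed
      then have "Rings.coprime p (u y)" using p by (simp add: prime_imp_coprime)
      then obtain s t where st: "s * p + t * u y = 1"
        by (metis bezout_int coprime_imp_gcd_eq_1)
      have "y = of_int (s * p + t * u y) * y" by (simp add: st)
      also have "\<dots> = of_int p * (of_int s * y) + of_int t * (of_int (u y) * y)"
        by (simp add: algebra_simps)
      also have "of_int (u y) * y = of_int p * z - (\<Sum>v\<in>V. of_int (u v) * v)"
        using eq by (simp add: algebra_simps)
      also have "of_int p * (of_int s * y) + of_int t * \<dots>
          = (\<Sum>v\<in>V. of_int (- t * u v) * v) + of_int p * (of_int s * y + of_int t * z)"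
        by (simp add: algebra_simps sum_distrib_left sum_negf)
      finally show ?thesis using u(1) y by (meson int_ring_add int_ring_mult int_ring_of_int)
    qed
    then obtain a z where a: "z \<in> \<O>" "y = (\<Sum>v\<in>V. of_int (a v) * v) + of_int p * z" by blast
    define b where "b = (\<lambda>v\<in>V. a v mod p)"
    have "(\<Sum>v\<in>V. of_int (a v) * v)
        = (\<Sum>v\<in>V. of_int (b v) * v + of_int p * (of_int (a v div p) * v))"
    proof (rule sum.cong)
      fix v assume "v \<in> V"
      have "of_int (a v) = (of_int (a v mod p) + of_int p * of_int (a v div p) :: 'a)"
        by (metis mod_mult_div_eq of_int_add of_int_mult)
      then show "of_int (a v) * v = of_int (b v) * v + of_int p * (of_int (a v div p) * v)"
        using \<open>v \<in> V\<close> by (simp only: b_def restrict_apply' distrib_right mult.assoc)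
    qed simp
    then have "y = (\<Sum>v\<in>V. of_int (b v) * v) + of_int p * ((\<Sum>v\<in>V. of_int (a v div p) * v) + z)"
      unfolding a(2) by (simp only: sum.distrib sum_distrib_left[symmetric] distrib_left add.assoc)
    moreover have "(\<Sum>v\<in>V. of_int (a v div p) * v) + z \<in> \<O>"
      using sub a(1) by (intro int_ring_intros) auto
    moreover have "b \<in> V \<rightarrow>\<^sub>E {0..<p}" using p by (auto simp: b_def prime_gt_0_int)
    ultimately show ?thesis unfolding S_def by blast
  qed
  moreover have "finite S" using fin by (simp add: S_def finite_PiE)
  moreover have "S \<subseteq> \<O>"
    unfolding S_def using sub by (intro image_subsetI int_ring_sum int_ring_mult int_ring_of_int) auto
  ultimately show ?thesis by blast
qed

text \<open>Mixed radix digits: a residue modulo \<open>p * n\<close> is \<open>t + p * s\<close>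
  with \<open>t\<close> taken modulo \<open>p\<close> and \<open>s\<close> modulo
  \<open>n\<close>.\<close>

lemma finite_residues:
  fixes n :: nat
  assumes "n > 0"
  shows "\<exists>S. finite S \<and> S \<subseteq> \<O> \<and> (\<forall>y\<in>\<O>. \<exists>s\<in>S. \<exists>z\<in>\<O>. y = s + of_nat n * z)"
  using assms
proof (induction n rule: prime_divisors_induct)
  case (unit n)
  then have "n = 1" by simp
  then show ?case using int_ring_0 by (intro exI[of _ "{0}"]) auto
next
  case (factor p n)
  then obtain S where S: "finite S" "S \<subseteq> \<O>" "\<And>y. y \<in> \<O> \<Longrightarrow> \<exists>s\<in>S. \<exists>z\<in>\<O>. y = s + of_nat n * z"
    by auto
  have "normalization_semidom_class.prime (int p)" using factor.hyps by simp
  from finite_residues_prime[OF this]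
  obtain T where T: "finite T" "T \<subseteq> \<O>" "\<And>y. y \<in> \<O> \<Longrightarrow> \<exists>s\<in>T. \<exists>z\<in>\<O>. y = s + of_nat p * z"
    by auto
  define U where "U = (\<lambda>(t, s). t + of_nat p * s) ` (T \<times> S)"
  have "\<exists>u\<in>U. \<exists>z\<in>\<O>. y = u + of_nat (p * n) * z" if "y \<in> \<O>" for y
  proof -
    obtain t z where t: "t \<in> T" "z \<in> \<O>" "y = t + of_nat p * z" using T(3)[OF \<open>y \<in> \<O>\<close>] by blast
    obtain s w where s: "s \<in> S" "w \<in> \<O>" "z = s + of_nat n * w" using S(3)[OF t(2)] by blast
    have "y = (t + of_nat p * s) + of_nat (p * n) * w" by (simp add: t(3) s(3) algebra_simps)
    then show ?thesis using t(1) s(1,2)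
      by (intro bexI[of _ "t + of_nat p * s"] bexI[of _ w]) (auto simp: U_def)
  qed
  moreover have "finite U" using S T by (simp add: U_def)
  moreover have "U \<subseteq> \<O>"
    using S(2) T(2) int_ring_of_int[of "int p"] by (auto simp: U_def intro!: int_ring_add int_ring_mult)
  ultimately show ?case by blast
qed simp

end

section \<open>Ideals of the ring of integers\<close>

text \<open>Dividing powers of the variable out of an annihilating polynomial leaves a nonzero
  constant term, which is a multiple of \<open>x\<close>. The cofactor is kept as an integer
  polynomial in \<open>x\<close> so that it stays in every ring containing \<open>x\<close>.\<close>

lemma algebraic_int_dvd_nat:
  fixes x :: "'a::field_char_0"
  assumes "algebraic_int x" "x \<noteq> 0"
  shows "\<exists>n>0. \<exists>q :: int poly. x * poly (map_poly of_int q) x = of_nat n"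
proof -
  have "\<exists>c\<noteq>0. \<exists>q :: int poly. x * poly (map_poly of_int q) x = of_int c"
    if "p \<noteq> 0" "poly (map_poly of_int p) x = 0" for p :: "int poly"
    using that
  proof (induction p rule: pCons_induct)
    case (pCons c p)
    have eq: "of_int c + x * poly (map_poly of_int p) x = 0"
      using pCons.prems(2) pCons.hyps by simp
    show ?case
    proof (cases "c = 0")
      case True
      then show ?thesis using pCons eq assms(2) by auto
    next
      case False
      have "x * poly (map_poly of_int p) x = of_int (- c)" using eq by (simp add: eq_neg_iff_add_eq_0 add.commute)
      then show ?thesis using False by (intro exI[of _ "- c"]) auto
    qed
  qed simp
  moreover obtain p :: "int poly" where "p \<noteq> 0" "poly (map_poly of_int p) x = 0"
    using assms(1) unfolding algebraic_int_altdef_ipoly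
    by (metis Polynomial.coeff_0 Polynomial.degree_0 zero_neq_one)
  ultimately obtain c q where c: "c \<noteq> 0" "x * poly (map_poly of_int q) x = (of_int c :: 'a)" by blast
  show ?thesis
  proof (cases "c > 0")
    case True
    then show ?thesis using c by (intro exI[of _ "nat c"]) auto
  next
    case False
    have "map_poly of_int (- q) = - (map_poly of_int q :: 'a poly)"
      by (rule poly_eqI) (simp add: coeff_map_poly)
    then have "x * poly (map_poly of_int (- q)) x = of_nat (nat (- c))" using c(2) False by simp
    then show ?thesis using False c(1) by (intro exI[of _ "nat (- c)"]) auto
  qed
qed

context number_field_integers
begin

lemma ex_multiple_nat:
  assumes "x \<in> \<O>" "x \<noteq> 0"
  shows "\<exists>n>0. \<exists>y\<in>\<O>. x * y = of_nat n"
proof -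
  obtain n q where "n > 0" "x * poly (map_poly of_int q) x = of_nat n"
    using algebraic_int_dvd_nat[of x] assms by (auto simp: int_ring_def)
  moreover have "poly (map_poly of_int q) x \<in> \<O>" for q :: "int poly"
    by (induction q rule: pCons_induct) (auto simp: assms intro!: int_ring_intros)
  ultimately show ?thesis by blast
qed

text \<open>The map \<open>\<rho>\<close> is not claimed to be constant on residue classes.
  Pigeonhole arguments need the other direction: equal values imply congruence modulo
  \<open>n\<close>.\<close>

lemma residue_map:
  fixes n :: nat
  assumes "n > 0"
  obtains \<rho> where "finite (\<rho> ` \<O>)" "\<rho> ` \<O> \<subseteq> \<O>" "\<And>y. y \<in> \<O> \<Longrightarrow> \<exists>w\<in>\<O>. y = \<rho> y + of_nat n * w"
proof -
  obtain S where S: "finite S" "S \<subseteq> \<O>" "\<And>y. y \<in> \<O> \<Longrightarrow> \<exists>s\<in>S. \<exists>z\<in>\<O>. y = s + of_nat n * z"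
    using finite_residues[OF assms] by blast
  then obtain \<rho> where \<rho>: "\<And>y. y \<in> \<O> \<Longrightarrow> \<rho> y \<in> S \<and> (\<exists>z\<in>\<O>. y = \<rho> y + of_nat n * z)"
    by metis
  show ?thesis
  proof
    have "\<rho> ` \<O> \<subseteq> S" using \<rho> by auto
    then show "finite (\<rho> ` \<O>)" "\<rho> ` \<O> \<subseteq> \<O>" using S finite_subset by blast+
  qed (use \<rho> in auto)
qed

section \<open>Ideals as plain sets, and finiteness of the ideals above a given one\<close>

abbreviation "R \<equiv> ring_of_integers K"

lemma carrier_R [simp]: "carrier R = \<O>" and mult_R [simp]: "x \<otimes>\<^bsub>R\<^esub> y = x * y"
  and add_R [simp]: "x \<oplus>\<^bsub>R\<^esub> y = x + y" and zero_R [simp]: "\<zero>\<^bsub>R\<^esub> = 0" and one_R [simp]: "\<one>\<^bsub>R\<^esub> = 1"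
  by (simp_all add: ring_of_integers_def int_ring_def)

lemma cring_R: "cring R"
proof (rule cringI)
  show "abelian_group R"
    by (rule abelian_groupI) (auto intro: int_ring_intros bexI[of _ "- x" for x])
  show "comm_monoid R"
    by (rule comm_monoidI) (auto intro: int_ring_intros)
qed (simp add: distrib_right)

sublocale R: cring R
  by (rule cring_R)

lemma a_inv_R [simp]: "x \<in> \<O> \<Longrightarrow> \<ominus>\<^bsub>R\<^esub> x = - x"
  using R.minus_equality[of "- x" x] int_ring_uminus by simp

lemma ideal_iff:
  "ideal I R \<longleftrightarrow> I \<subseteq> \<O> \<and> 0 \<in> I \<and> (\<forall>x\<in>I. \<forall>y\<in>I. x + y \<in> I) \<and> (\<forall>a\<in>\<O>. \<forall>x\<in>I. a * x \<in> I)"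
  (is "_ \<longleftrightarrow> ?rhs")
proof
  assume "ideal I R"
  then interpret ideal I R .
  show ?rhs using a_subset zero_closed a_closed I_l_closed by auto
next
  assume r: ?rhs
  show "ideal I R"
  proof (rule idealI)
    show "ring R" by (rule R.ring_axioms)
    have "- x \<in> I" if "x \<in> I" for x
    proof -
      have "(-1) * x \<in> I" using r that int_ring_uminus[OF int_ring_1] by blast
      then show ?thesis by simp
    qed
    then show "subgroup I (add_monoid R)"
      using r by (intro R.add.subgroupI) (auto simp flip: a_inv_def)
    fix a x assume "a \<in> I" "x \<in> carrier R"
    then have "x * a \<in> I" using r by simp
    then show "x \<otimes>\<^bsub>R\<^esub> a \<in> I" "a \<otimes>\<^bsub>R\<^esub> x \<in> I" by (simp_all add: mult.commute)
  qed
qed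

lemma idealD:
  assumes "ideal I R"
  shows "I \<subseteq> \<O>" "0 \<in> I" "x \<in> I \<Longrightarrow> y \<in> I \<Longrightarrow> x + y \<in> I" "a \<in> \<O> \<Longrightarrow> x \<in> I \<Longrightarrow> a * x \<in> I"
    "a \<in> \<O> \<Longrightarrow> x \<in> I \<Longrightarrow> x * a \<in> I"
  using assms by (auto simp: ideal_iff mult.commute)

lemma ideal_diff: "ideal I R \<Longrightarrow> x \<in> I \<Longrightarrow> y \<in> I \<Longrightarrow> x - y \<in> I"
  using idealD(3)[of I x "(-1) * y"] idealD(4)[of I "-1" y] int_ring_uminus[OF int_ring_1] by simp

lemma ideal_eq_if_one_mem: "ideal I R \<Longrightarrow> 1 \<in> I \<Longrightarrow> I = \<O>"
  using idealD(1,4)[of I] by force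

lemma ideal_principal: "a \<in> \<O> \<Longrightarrow> ideal ((*) a ` \<O>) R"
  unfolding ideal_iff
proof (intro conjI ballI)
  fix x y assume "x \<in> (*) a ` \<O>" "y \<in> (*) a ` \<O>"
  then show "x + y \<in> (*) a ` \<O>" using int_ring_add by (auto simp flip: distrib_left)
qed (auto simp: image_iff mult.left_commute intro: int_ring_intros)

lemma ideal_prod_subset:
  assumes "ideal T R" "\<And>i j. i \<in> I \<Longrightarrow> j \<in> J \<Longrightarrow> i * j \<in> T"
  shows "ideal_prod R I J \<subseteq> T"
proof
  fix x assume "x \<in> ideal_prod R I J"
  then show "x \<in> T" by induction (use assms idealD(3)[OF assms(1)] in auto)
qed

lemma nonzero_ideal_iff: "I \<in> nonzero_ideals R \<longleftrightarrow> ideal I R \<and> (\<exists>x\<in>I. x \<noteq> 0)"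
  using idealD(2)[of I] by (auto simp: nonzero_ideals_def)

lemma nonzero_prime_iff: "P \<in> nonzero_primes R \<longleftrightarrow> primeideal P R \<and> P \<in> nonzero_ideals R"
  by (auto simp: nonzero_primes_def nonzero_ideals_def primeideal.axioms)

lemma nonzero_ideal_nat:
  assumes "I \<in> nonzero_ideals R"
  shows "\<exists>n>0. of_nat n \<in> I"
proof -
  obtain x where x: "ideal I R" "x \<in> I" "x \<noteq> 0" using assms nonzero_ideal_iff by blast
  then obtain n y where "n > 0" "y \<in> \<O>" "x * y = of_nat n"
    using ex_multiple_nat idealD(1) by blast
  then show ?thesis using idealD(5)[OF x(1), of y x] x(2) by (intro exI[of _ n]) auto
qed

lemma carrier_nonzero_ideal: "\<O> \<in> nonzero_ideals R"
  by (auto simp: nonzero_ideal_iff ideal_iff int_ring_intros intro: bexI[of _ 1])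

lemma ideal_prod_nonzero:
  assumes "I \<in> nonzero_ideals R" "J \<in> nonzero_ideals R"
  shows "ideal_prod R I J \<in> nonzero_ideals R"
proof -
  obtain x y where "x \<in> I" "y \<in> J" "x \<noteq> 0" "y \<noteq> 0" and IJ: "ideal I R" "ideal J R"
    using assms unfolding nonzero_ideal_iff by blast
  moreover from this have "x * y \<in> ideal_prod R I J"
    using ideal_prod.prod[of x I y J R] by simp
  ultimately show ?thesis
    unfolding nonzero_ideal_iff by (auto intro!: R.ideal_prod_is_ideal bexI[of _ "x * y"])
qed

text \<open>An ideal containing \<open>n\<close> is a union of residue classes modulo
  \<open>n\<close>, so its trace on the finitely many representatives determines it.\<close>

lemma finite_ideals_containing:
  assumes "n > 0"
  shows "finite {J. ideal J R \<and> of_nat n \<in> J}"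
proof -
  obtain \<rho> where \<rho>: "finite (\<rho> ` \<O>)" "\<rho> ` \<O> \<subseteq> \<O>" "\<And>y. y \<in> \<O> \<Longrightarrow> \<exists>w\<in>\<O>. y = \<rho> y + of_nat n * w"
    using residue_map[OF assms] by blast
  have mem: "y \<in> J \<longleftrightarrow> y \<in> \<O> \<and> \<rho> y \<in> J" if J: "ideal J R" "of_nat n \<in> J" for J y
  proof (cases "y \<in> \<O>")
    case True
    then obtain w where w: "w \<in> \<O>" "y = \<rho> y + of_nat n * w" using \<rho>(3) by blast
    have "of_nat n * w \<in> J" using J w(1) idealD(5) by blast
    moreover have "\<rho> y = y - of_nat n * w" by (simp only: eq_diff_eq w(2)[symmetric])
    ultimately show ?thesis
      using w(2) True ideal_diff[OF J(1), of y "of_nat n * w"] idealD(3)[OF J(1), of "\<rho> y" "of_nat n * w"]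
      by metis
  qed (use J idealD(1) in blast)
  have "inj_on (\<lambda>J. J \<inter> \<rho> ` \<O>) {J. ideal J R \<and> of_nat n \<in> J}"
  proof (rule inj_onI)
    fix I J assume *: "I \<in> {J. ideal J R \<and> of_nat n \<in> J}" "J \<in> {J. ideal J R \<and> of_nat n \<in> J}"
      "I \<inter> \<rho> ` \<O> = J \<inter> \<rho> ` \<O>"
    have "y \<in> I \<longleftrightarrow> y \<in> J" for y
      using mem[of I y] mem[of J y] * by blast
    then show "I = J" by blast
  qed
  moreover have "finite ((\<lambda>J. J \<inter> \<rho> ` \<O>) ` {J. ideal J R \<and> of_nat n \<in> J})"
    by (rule finite_subset[of _ "Pow (\<rho> ` \<O>)"]) (use \<rho>(1) in auto)
  ultimately show ?thesis using finite_imageD by blast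
qed

lemma finite_ideals_above:
  assumes "I \<in> nonzero_ideals R"
  shows "finite {J. ideal J R \<and> I \<subseteq> J}"
proof -
  obtain n where "n > 0" "of_nat n \<in> I" using nonzero_ideal_nat[OF assms] by blast
  then show ?thesis
    by (intro finite_subset[OF _ finite_ideals_containing[of n]]) auto
qed

text \<open>The measure is the number of ideals above \<open>I\<close>; passing to a larger ideal
  drops at least \<open>I\<close> itself from the count.\<close>

lemma ideal_superset_induct [consumes 1, case_names less]:
  assumes "I \<in> nonzero_ideals R"
    and "\<And>I. I \<in> nonzero_ideals R \<Longrightarrow> (\<And>J. ideal J R \<Longrightarrow> I \<subset> J \<Longrightarrow> Q J) \<Longrightarrow> Q I"
  shows "Q I"
  using assms(1)
proof (induction "card {J. ideal J R \<and> I \<subseteq> J}" arbitrary: I rule: less_induct)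
  case less
  show ?case
  proof (rule assms(2)[OF less.prems])
    fix J assume J: "ideal J R" "I \<subset> J"
    have "card {M. ideal M R \<and> J \<subseteq> M} < card {M. ideal M R \<and> I \<subseteq> M}"
    proof (rule psubset_card_mono)
      show "finite {M. ideal M R \<and> I \<subseteq> M}" by (rule finite_ideals_above[OF less.prems])
      have "I \<in> {M. ideal M R \<and> I \<subseteq> M}" using less.prems by (simp add: nonzero_ideal_iff)
      then show "{M. ideal M R \<and> J \<subseteq> M} \<subset> {M. ideal M R \<and> I \<subseteq> M}" using J by auto
    qed
    moreover have "J \<in> nonzero_ideals R" using J less.prems unfolding nonzero_ideal_iff by blast
    ultimately show "Q J" by (rule less.hyps)
  qed
qed

text \<open>Modulo a nonzero prime, two powers of \<open>a\<close> agree, so \<open>a\<close> is invertible.\<close>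

lemma prime_inverse_mod:
  assumes P: "P \<in> nonzero_primes R" and a: "a \<in> \<O>" "a \<notin> P"
  shows "\<exists>e\<in>P. \<exists>r\<in>\<O>. 1 = e + r * a"
proof -
  have prime: "primeideal P R" and id: "ideal P R" and nz: "P \<in> nonzero_ideals R"
    using P by (auto simp: nonzero_prime_iff nonzero_ideal_iff)
  obtain n where n: "n > 0" "of_nat n \<in> P" using nonzero_ideal_nat[OF nz] by blast
  obtain \<rho> where \<rho>: "finite (\<rho> ` \<O>)" "\<And>y. y \<in> \<O> \<Longrightarrow> \<exists>w\<in>\<O>. y = \<rho> y + of_nat n * w"
    using residue_map[OF n(1)] by metis
  have "finite (range (\<lambda>i::nat. \<rho> (a ^ i)))"
    by (rule finite_subset[OF _ \<rho>(1)]) (auto simp: a int_ring_power)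
  then have "\<not> inj (\<lambda>i::nat. \<rho> (a ^ i))" using finite_imageD infinite_UNIV_nat by blast
  then obtain i j where ij: "i < j" "\<rho> (a ^ i) = \<rho> (a ^ j)"
    unfolding inj_on_def by (metis nat_neq_iff)
  obtain u v w where vw: "v \<in> \<O>" "w \<in> \<O>" "a ^ i = u + of_nat n * v" "a ^ j = u + of_nat n * w"
    using \<rho>(2)[OF int_ring_power[OF a(1)], of i] \<rho>(2)[OF int_ring_power[OF a(1)], of j] ij(2) by metis
  \<comment> \<open>No power of \<open>a\<close> lies in \<open>P\<close>, so primality cancels
    \<open>a ^ i\<close> from this product; what remains shows that \<open>a ^ (j - i - 1)\<close>
    inverts \<open>a\<close>.\<close>
  have "a ^ i * (1 - a ^ (j - i)) = a ^ i - a ^ j"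
    using ij(1) by (simp add: algebra_simps flip: power_add)
  also have "\<dots> = of_nat n * (v - w)"
    unfolding vw(3,4) by (simp add: algebra_simps)
  also have "\<dots> \<in> P" using n(2) vw(1,2) idealD(5)[OF id] int_ring_diff by blast
  finally have "a ^ i * (1 - a ^ (j - i)) \<in> P" .
  moreover have "a ^ m \<notin> P" for m
  proof (induction m)
    case 0
    then show ?case using ideal_eq_if_one_mem[OF id] primeideal.I_notcarr[OF prime] by auto
  next
    case (Suc m)
    then show ?case using primeideal.I_prime[OF prime, of a "a ^ m"] a int_ring_power by auto
  qed
  moreover have "a ^ i \<in> \<O>" "1 - a ^ (j - i) \<in> \<O>" using a(1) by (auto intro!: int_ring_intros)
  ultimately have "1 - a ^ (j - i) \<in> P"
    using primeideal.I_prime[OF prime, of "a ^ i" "1 - a ^ (j - i)"] by auto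
  moreover have "1 = 1 - a ^ (j - i) + a ^ (j - i - 1) * a"
    using ij(1) by (simp add: Suc_diff_Suc flip: power_Suc2)
  ultimately show ?thesis using a(1) int_ring_power by metis
qed

lemma prime_maximal:
  assumes P: "P \<in> nonzero_primes R" and J: "ideal J R" "P \<subseteq> J" "J \<noteq> \<O>"
  shows "J = P"
proof (rule ccontr)
  assume "J \<noteq> P"
  then obtain a where a: "a \<in> J" "a \<notin> P" using J(2) by blast
  then obtain e r where e: "e \<in> P" "r \<in> \<O>" "1 = e + r * a"
    using prime_inverse_mod[OF P] idealD(1)[OF J(1)] by blast
  then have "e + r * a \<in> J" using a(1) J(2) idealD(3,4)[OF J(1)] by blast
  then show False using e(3) ideal_eq_if_one_mem[OF J(1)] J(3) by metis
qed

text \<open>The ideals generated by \<open>n, n x, \<dots>, n x\<^sup>j\<close> all contain \<open>n\<close>, so two of them agree, which yields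
  an integral equation for \<open>x\<close>.\<close>

lemma almost_integral:
  assumes x: "x \<in> K" and a: "a \<in> \<O>" "a \<noteq> 0" and pow: "\<And>j. a * x ^ j \<in> \<O>"
  shows "x \<in> \<O>"
proof -
  obtain n y where n: "n > 0" "y \<in> \<O>" "a * y = of_nat n" using ex_multiple_nat[OF a] by blast
  have npow: "of_nat n * x ^ j \<in> \<O>" for j
    using int_ring_mult[OF pow[of j] n(2)] by (simp add: mult_ac flip: n(3))
  define J where "J j = {\<Sum>k\<le>j. c k * (of_nat n * x ^ k) |c. \<forall>k\<le>j. c k \<in> \<O>}" for j :: nat
  have J: "ideal (J j) R" for j
    unfolding ideal_iff
  proof (intro conjI ballI)
    show "J j \<subseteq> \<O>" unfolding J_def using npow by (auto intro!: int_ring_sum intro: int_ring_mult)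
    show "0 \<in> J j" unfolding J_def using int_ring_0 by (auto intro!: exI[of _ "\<lambda>_. 0"])
  next
    fix u v assume "u \<in> J j" "v \<in> J j"
    then obtain c d where "\<forall>k\<le>j. c k \<in> \<O>" "u = (\<Sum>k\<le>j. c k * (of_nat n * x ^ k))"
      "\<forall>k\<le>j. d k \<in> \<O>" "v = (\<Sum>k\<le>j. d k * (of_nat n * x ^ k))" unfolding J_def by blast
    then show "u + v \<in> J j" unfolding J_def
      by (auto intro!: exI[of _ "\<lambda>k. c k + d k"] simp: distrib_right sum.distrib int_ring_add)
  next
    fix b u assume "b \<in> \<O>" "u \<in> J j"
    then obtain c where "\<forall>k\<le>j. c k \<in> \<O>" "u = (\<Sum>k\<le>j. c k * (of_nat n * x ^ k))" unfolding J_def by blast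
    then show "b * u \<in> J j" unfolding J_def using \<open>b \<in> \<O>\<close>
      by (auto intro!: exI[of _ "\<lambda>k. b * c k"] simp: sum_distrib_left mult.assoc int_ring_mult)
  qed
  have mem: "of_nat n * x ^ i \<in> J j" if "i \<le> j" for i j
  proof -
    have "of_nat n * x ^ i = (\<Sum>k\<le>j. (if k = i then 1 else 0) * (of_nat n * x ^ k))"
      using that by (simp add: if_distrib[of "\<lambda>c. c * _"] cong: if_cong)
    then show ?thesis unfolding J_def using int_ring_0 int_ring_1
      by (intro CollectI exI[of _ "\<lambda>k. if k = i then 1 else 0"]) auto
  qed
  have "finite (range J)"
    by (rule finite_subset[OF _ finite_ideals_containing[OF n(1)]]) (use J mem[of 0] in auto)
  then have "\<not> inj J" using finite_imageD infinite_UNIV_nat by blast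
  then obtain i j where ij: "i < j" "J i = J j"
    unfolding inj_on_def by (metis nat_neq_iff)
  then have "of_nat n * x ^ j \<in> J i" using mem[of j j] by simp
  then obtain c where c: "\<forall>k\<le>i. c k \<in> \<O>" "of_nat n * x ^ j = (\<Sum>k\<le>i. c k * (of_nat n * x ^ k))"
    unfolding J_def by blast
  have "of_nat n * x ^ j = of_nat n * (\<Sum>k\<le>i. c k * x ^ k)"
    unfolding c(2) by (simp add: sum_distrib_left mult.left_commute)
  then have "x ^ j = (\<Sum>k\<le>i. c k * x ^ k)" using n(1) by simp
  \<comment> \<open>Zero coefficients pad the sum to all exponents below \<open>j\<close>, the shape
    of an integral equation of degree \<open>j\<close>.\<close>
  also have "\<dots> = (\<Sum>k<j. (if k \<le> i then c k else 0) * x ^ k)"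
    using ij(1) by (intro sum.mono_neutral_cong_left) auto
  finally have "algebraic_int x"
    by (rule algebraic_int_integral) (use c(1) in \<open>auto simp: int_ring_def\<close>)
  then show ?thesis using x by (simp add: int_ring_def)
qed

end

section \<open>Prime factorization of ideals\<close>

context number_field_integers
begin

abbreviation "word_prod \<equiv> ideal_word_prod R"

lemma word_prod_Nil [simp]: "word_prod [] = \<O>"
  and word_prod_Cons [simp]: "word_prod (I # w) = I \<cdot>\<^bsub>R\<^esub> word_prod w"
  by (simp_all add: ideal_word_prod_def)

lemma nonzero_idealD: "I \<in> nonzero_ideals R \<Longrightarrow> ideal I R"
  by (simp add: nonzero_ideal_iff)

lemma nonzero_prime_imp_ideal: "P \<in> nonzero_primes R \<Longrightarrow> P \<in> nonzero_ideals R"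
  by (simp add: nonzero_prime_iff)

lemma
  assumes "I \<in> nonzero_ideals R"
  shows ideal_mult_carrier: "I \<cdot>\<^bsub>R\<^esub> \<O> = I"
    and carrier_ideal_mult: "\<O> \<cdot>\<^bsub>R\<^esub> I = I"
proof -
  have I: "ideal I R" "ideal \<O> R" using assms carrier_nonzero_ideal nonzero_idealD by auto
  show "I \<cdot>\<^bsub>R\<^esub> \<O> = I" using R.ideal_prod_one[OF I(1)] by simp
  then show "\<O> \<cdot>\<^bsub>R\<^esub> I = I" using R.ideal_prod_commute[OF I] by simp
qed

lemma ideal_mult_commute:
  "I \<in> nonzero_ideals R \<Longrightarrow> J \<in> nonzero_ideals R \<Longrightarrow> I \<cdot>\<^bsub>R\<^esub> J = J \<cdot>\<^bsub>R\<^esub> I"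
  by (intro R.ideal_prod_commute nonzero_idealD)

lemma ideal_mult_assoc:
  "I \<in> nonzero_ideals R \<Longrightarrow> J \<in> nonzero_ideals R \<Longrightarrow> M \<in> nonzero_ideals R \<Longrightarrow>
    I \<cdot>\<^bsub>R\<^esub> J \<cdot>\<^bsub>R\<^esub> M = I \<cdot>\<^bsub>R\<^esub> (J \<cdot>\<^bsub>R\<^esub> M)"
  by (intro R.ideal_prod_assoc nonzero_idealD)

lemma word_prod_nonzero: "w \<in> lists (nonzero_ideals R) \<Longrightarrow> word_prod w \<in> nonzero_ideals R"
  by (induction w) (auto simp: carrier_nonzero_ideal ideal_prod_nonzero)

lemma prime_words_ideal_words: "w \<in> lists (nonzero_primes R) \<Longrightarrow> w \<in> lists (nonzero_ideals R)"
  using nonzero_prime_imp_ideal by auto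

lemma word_prod_append:
  "v \<in> lists (nonzero_ideals R) \<Longrightarrow> w \<in> lists (nonzero_ideals R) \<Longrightarrow>
    word_prod (v @ w) = word_prod v \<cdot>\<^bsub>R\<^esub> word_prod w"
  by (induction v) (auto simp: carrier_ideal_mult word_prod_nonzero ideal_mult_assoc)

lemma word_prod_extract:
  assumes "v \<in> lists (nonzero_ideals R)" "w \<in> lists (nonzero_ideals R)" "I \<in> nonzero_ideals R"
  shows "word_prod (v @ I # w) = I \<cdot>\<^bsub>R\<^esub> word_prod (v @ w)"
  using assms word_prod_nonzero[OF assms(1)] word_prod_nonzero[OF assms(2)]
  by (simp add: word_prod_append ideal_mult_assoc[symmetric] ideal_mult_commute)

text \<open>If \<open>I\<close> is not prime, there are \<open>a\<close> and \<open>b\<close>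
  outside \<open>I\<close> with product in \<open>I\<close>; adjoining either one gives a strictly
  larger ideal, and the product of the two ideals lies in \<open>I\<close>.\<close>

lemma ex_prime_word_subset:
  assumes "I \<in> nonzero_ideals R"
  shows "\<exists>w\<in>lists (nonzero_primes R). word_prod w \<subseteq> I"
  using assms
proof (induction I rule: ideal_superset_induct)
  case (less I)
  have I: "ideal I R" by (rule nonzero_idealD[OF less.hyps(1)])
  consider "I = \<O>" | "I \<noteq> \<O>" "primeideal I R" | "I \<noteq> \<O>" "\<not> primeideal I R" by blast
  then show ?case
  proof cases
    case 1
    then show ?thesis by (intro bexI[of _ "[]"]) auto
  next
    case 2
    then have "I \<in> nonzero_primes R" using less.hyps(1) by (simp add: nonzero_prime_iff)
    then show ?thesis
      using ideal_mult_carrier[OF less.hyps(1)] by (intro bexI[of _ "[I]"]) auto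
  next
    case 3
    then obtain a b where ab: "a \<in> \<O>" "b \<in> \<O>" "a * b \<in> I" "a \<notin> I" "b \<notin> I"
      using primeidealI[OF I R.is_cring] by auto
    define J where "J c = {x + r * c |x r. x \<in> I \<and> r \<in> \<O>}" for c
    have mem: "x \<in> J c" if "x \<in> I" for x c
      unfolding J_def using that int_ring_0 by (intro CollectI exI[of _ x] exI[of _ 0]) auto
    have gen: "c \<in> J c" for c
      unfolding J_def using idealD(2)[OF I] int_ring_1 by (intro CollectI exI[of _ 0] exI[of _ 1]) auto
    have J: "ideal (J c) R" if "c \<in> \<O>" for c
      unfolding ideal_iff
    proof (intro conjI ballI)
      show "J c \<subseteq> \<O>" using that idealD(1)[OF I] by (auto simp: J_def intro!: int_ring_add int_ring_mult)
      show "0 \<in> J c" using mem idealD(2)[OF I] by blast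
    next
      fix u v assume "u \<in> J c" "v \<in> J c"
      then obtain x r y s where "x \<in> I" "r \<in> \<O>" "y \<in> I" "s \<in> \<O>" "u = x + r * c" "v = y + s * c"
        unfolding J_def by blast
      then show "u + v \<in> J c" unfolding J_def
        using idealD(3)[OF I, of x y] int_ring_add[of r s]
        by (intro CollectI exI[of _ "x + y"] exI[of _ "r + s"]) (auto simp: algebra_simps)
    next
      fix a u assume "a \<in> \<O>" "u \<in> J c"
      then obtain x r where "x \<in> I" "r \<in> \<O>" "u = x + r * c"
        unfolding J_def by blast
      then show "a * u \<in> J c" unfolding J_def
        using \<open>a \<in> \<O>\<close> idealD(4)[OF I, of a x] int_ring_mult[of a r]
        by (intro CollectI exI[of _ "a * x"] exI[of _ "a * r"]) (auto simp: algebra_simps)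
    qed
    have "\<exists>w\<in>lists (nonzero_primes R). word_prod w \<subseteq> J c" if "c \<in> \<O>" "c \<notin> I" for c
      using mem gen that by (intro less.IH J) blast+
    from this[OF ab(1,4)] this[OF ab(2,5)]
    obtain v w where vw: "v \<in> lists (nonzero_primes R)" "word_prod v \<subseteq> J a"
      "w \<in> lists (nonzero_primes R)" "word_prod w \<subseteq> J b"
      by auto
    have "x * y \<in> I" if xy: "x \<in> word_prod v" "y \<in> word_prod w" for x y
    proof -
      obtain x' r where x: "x' \<in> I" "r \<in> \<O>" "x = x' + r * a" using xy vw(2) unfolding J_def by blast
      obtain y' s where y: "y' \<in> I" "s \<in> \<O>" "y = y' + s * b" using xy vw(4) unfolding J_def by blast
      have "y \<in> \<O>" using y ab idealD(1)[OF I] by (auto intro!: int_ring_add int_ring_mult)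
      then have "x' * y \<in> I" using x(1) idealD(5)[OF I] by blast
      moreover have "(r * a) * y' \<in> I" using x(2) ab(1) y(1) idealD(4)[OF I] int_ring_mult by blast
      moreover have "(r * s) * (a * b) \<in> I" using x(2) y(2) ab(3) idealD(4)[OF I] int_ring_mult by blast
      ultimately have "x' * y + ((r * a) * y' + (r * s) * (a * b)) \<in> I" using idealD(3)[OF I] by blast
      then show ?thesis by (simp add: x(3) y(3) algebra_simps)
    qed
    then have "word_prod (v @ w) \<subseteq> I"
      using vw(1,3) word_prod_append[of v w] ideal_prod_subset[OF I] prime_words_ideal_words by metis
    then show ?thesis using vw(1,3) by (intro bexI[of _ "v @ w"]) auto
  qed
qed

text \<open>A prime containing a product contains a factor, and maximality of nonzero primes makes
  that factor equal to it.\<close>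

lemma prime_word_subset_prime:
  assumes "P \<in> nonzero_primes R" "w \<in> lists (nonzero_primes R)" "word_prod w \<subseteq> P"
  shows "P \<in> set w"
  using assms(2,3)
proof (induction w rule: list.induct)
  case Nil
  then show ?case
    using assms(1) primeideal.I_notcarr[of P R] idealD(1)[OF nonzero_idealD, of P]
    by (auto simp: nonzero_prime_iff)
next
  case (Cons Q w)
  then have Q: "Q \<in> nonzero_primes R" "ideal Q R" and w: "w \<in> lists (nonzero_primes R)"
    using nonzero_idealD nonzero_prime_imp_ideal by auto
  have "ideal (word_prod w) R"
    using w prime_words_ideal_words word_prod_nonzero nonzero_idealD by blast
  then have "Q \<subseteq> P \<or> word_prod w \<subseteq> P"
    using R.primeideal_divides_ideal_prod[of P Q "word_prod w"] Q assms(1) Cons.prems(2)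
    by (simp add: nonzero_prime_iff)
  then show ?case
  proof
    assume "Q \<subseteq> P"
    then have "P = Q"
      using prime_maximal[OF Q(1), of P] assms(1) primeideal.I_notcarr[of P R] nonzero_idealD
      by (auto simp: nonzero_prime_iff)
    then show ?thesis by simp
  qed (use Cons.IH[OF w] in simp)
qed

text \<open>The witness \<open>x = b / a\<close> comes from a shortest product of primes inside a principal ideal
  \<open>a \<O> \<subseteq> P\<close>: one factor is \<open>P\<close>, and \<open>b\<close> lies in the product of the others but not in \<open>a \<O>\<close>.\<close>

lemma ex_prime_denominator:
  assumes P: "P \<in> nonzero_primes R"
  shows "\<exists>x\<in>K. x \<notin> \<O> \<and> (\<forall>c\<in>P. x * c \<in> \<O>)"
proof -
  have id: "ideal P R" using P nonzero_prime_imp_ideal nonzero_idealD by blast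
  obtain a where a: "a \<in> P" "a \<noteq> 0" "a \<in> \<O>"
    using P nonzero_prime_imp_ideal idealD(1)[OF id] nonzero_ideal_iff by blast
  define A where "A = (*) a ` \<O>"
  have A: "ideal A R" "a \<in> A"
    using ideal_principal[OF a(3)] int_ring_1 by (auto simp: A_def intro!: image_eqI[of _ _ 1])
  then have "A \<in> nonzero_ideals R" using a(2) by (auto simp: nonzero_ideal_iff)
  then obtain w0 where "w0 \<in> lists (nonzero_primes R) \<and> word_prod w0 \<subseteq> A"
    using ex_prime_word_subset by blast
  then obtain w where w: "w \<in> lists (nonzero_primes R)" "word_prod w \<subseteq> A"
    and min: "\<And>v. v \<in> lists (nonzero_primes R) \<Longrightarrow> word_prod v \<subseteq> A \<Longrightarrow> length w \<le> length v"
    using ex_has_least_nat[of "\<lambda>w. w \<in> lists (nonzero_primes R) \<and> word_prod w \<subseteq> A" w0 length]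
    by blast
  have "A \<subseteq> P" using idealD(5)[OF id _ a(1)] by (auto simp: A_def)
  then have "P \<in> set w" using prime_word_subset_prime[OF P w(1)] w(2) by blast
  then obtain u v where uv: "w = u @ P # v" by (meson split_list)
  then have "\<not> word_prod (u @ v) \<subseteq> A" using min[of "u @ v"] w(1) by auto
  then obtain b where b: "b \<in> word_prod (u @ v)" "b \<notin> A" by blast
  have "word_prod (u @ v) \<in> nonzero_ideals R"
    using uv w(1) by (intro word_prod_nonzero prime_words_ideal_words) auto
  then have bO: "b \<in> \<O>" using b(1) idealD(1) nonzero_idealD by blast
  have prod: "word_prod w = P \<cdot>\<^bsub>R\<^esub> word_prod (u @ v)"
    unfolding uv using w(1) P uv nonzero_prime_imp_ideal by (intro word_prod_extract) auto
  have "(b / a) * c \<in> \<O>" if "c \<in> P" for c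
  proof -
    have "c * b \<in> A" using ideal_prod.prod[OF that b(1), of R] prod w(2) by auto
    then show ?thesis using a(2) by (auto simp: A_def mult.commute)
  qed
  moreover have "b / a \<notin> \<O>"
  proof
    assume "b / a \<in> \<O>"
    then have "a * (b / a) \<in> A" unfolding A_def by blast
    then show False using a(2) b(2) by simp
  qed
  moreover have "b / a \<in> K"
    using mult_mem[OF int_ring_imp_mem[OF bO] inverse_mem[OF int_ring_imp_mem[OF a(3)]]]
    by (simp add: divide_inverse)
  ultimately show ?thesis by blast
qed

text \<open>A nonzero element of \<open>I\<close> is a common denominator of all powers of
  \<open>x\<close>. Later this is read contrapositively: a nonintegral \<open>x\<close> moves some
  element of the ideal out of it.\<close>

lemma integral_if_stabilizes_ideal:
  assumes "I \<in> nonzero_ideals R" "x \<in> K" "\<And>a. a \<in> I \<Longrightarrow> x * a \<in> I"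
  shows "x \<in> \<O>"
proof -
  obtain a where a: "a \<in> I" "a \<noteq> 0" "a \<in> \<O>"
    using assms(1) nonzero_ideal_iff idealD(1) by blast
  have "a * x ^ j \<in> I" for j
  proof (induction j)
    case (Suc j)
    then have "x * (a * x ^ j) \<in> I" by (rule assms(3))
    then show ?case by (simp add: mult.left_commute)
  qed (simp add: a(1))
  then show ?thesis
    using almost_integral[OF assms(2) a(3,2)] idealD(1)[OF nonzero_idealD[OF assms(1)]] by blast
qed

lemma ex_prime_above:
  assumes "I \<in> nonzero_ideals R" "I \<noteq> \<O>"
  shows "\<exists>P\<in>nonzero_primes R. I \<subseteq> P"
proof -
  define S where "S = {J. ideal J R \<and> I \<subseteq> J \<and> J \<noteq> \<O>}"
  have "finite S"
    unfolding S_def by (rule finite_subset[OF _ finite_ideals_above[OF assms(1)]]) auto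
  moreover have "S \<noteq> {}" using assms nonzero_idealD unfolding S_def by blast
  ultimately obtain P where "P \<in> S" "\<forall>J\<in>S. P \<le> J \<longrightarrow> P = J"
    using finite_has_maximal[of S] by blast
  then have P: "ideal P R" "I \<subseteq> P" "P \<noteq> \<O>"
    and max: "\<And>J. ideal J R \<Longrightarrow> P \<subseteq> J \<Longrightarrow> J \<noteq> \<O> \<Longrightarrow> P = J"
    by (auto simp: S_def)
  have "maximalideal P R"
  proof (rule maximalidealI)
    fix J assume "ideal J R" "P \<subseteq> J"
    then show "J = P \<or> J = carrier R" using max by auto
  qed (use P in auto)
  then have "primeideal P R" by (rule R.maximalideal_prime)
  moreover have "P \<in> nonzero_ideals R" using P(1,2) assms(1) by (auto simp: nonzero_ideal_iff)
  ultimately show ?thesis using P(2) by (auto simp: nonzero_prime_iff)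
qed

text \<open>For \<open>P \<supseteq> I\<close> the quotient \<open>(I : P)\<close> strictly contains \<open>I\<close> and satisfies \<open>P \<cdot>\<^bsub>R\<^esub> (I : P) = I\<close>.\<close>

theorem prime_factorization:
  assumes "I \<in> nonzero_ideals R"
  shows "\<exists>w\<in>lists (nonzero_primes R). word_prod w = I"
  using assms
proof (induction I rule: ideal_superset_induct)
  case (less I)
  have I: "ideal I R" by (rule nonzero_idealD[OF less.hyps(1)])
  show ?case
  proof (cases "I = \<O>")
    case True
    then show ?thesis by (intro bexI[of _ "[]"]) auto
  next
    case False
    then obtain P where P: "P \<in> nonzero_primes R" "I \<subseteq> P" using ex_prime_above[OF less.hyps(1)] by blast
    have nzP: "P \<in> nonzero_ideals R" and idP: "ideal P R"
      using P(1) nonzero_prime_imp_ideal nonzero_idealD by auto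
    obtain x where x: "x \<in> K" "x \<notin> \<O>" "\<And>c. c \<in> P \<Longrightarrow> x * c \<in> \<O>"
      using ex_prime_denominator[OF P(1)] by blast
    define J where "J = {y \<in> \<O>. \<forall>c\<in>P. y * c \<in> I}"
    have J: "ideal J R"
      unfolding ideal_iff
    proof (intro conjI ballI)
      fix y z assume "y \<in> J" "z \<in> J"
      then show "y + z \<in> J" using idealD(3)[OF I] by (auto simp: J_def distrib_right int_ring_add)
    next
      fix b y assume "b \<in> \<O>" "y \<in> J"
      then show "b * y \<in> J" using idealD(4)[OF I] by (auto simp: J_def mult.assoc int_ring_mult)
    qed (auto simp: J_def int_ring_0 idealD(2)[OF I])
    \<comment> \<open>Integrality of \<open>y\<close> comes for free: \<open>y\<close> maps
      \<open>P\<close> into \<open>I\<close>, hence into \<open>P\<close>, and stabilizing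
      \<open>P\<close> makes it integral.\<close>
    have memJ: "y \<in> J" if "y \<in> K" "\<And>c. c \<in> P \<Longrightarrow> y * c \<in> I" for y
      using integral_if_stabilizes_ideal[OF nzP that(1)] that(2) P(2) unfolding J_def by blast
    have "I \<subseteq> J" using idealD(1)[OF I] idealD(1)[OF idP] idealD(5)[OF I] by (auto simp: J_def)
    have xI: "x * z \<in> J" if "z \<in> I" for z
    proof (rule memJ)
      show "x * z \<in> K" using that x(1) idealD(1)[OF I] int_ring_imp_mem mult_mem by blast
      fix c assume "c \<in> P"
      then have "(x * c) * z \<in> I" using x(3) that idealD(4)[OF I] by blast
      then show "x * z * c \<in> I" by (simp add: mult_ac)
    qed
    \<comment> \<open>Otherwise \<open>x\<close> would stabilize \<open>I\<close> and be
      integral.\<close>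
    have "I \<noteq> J"
      using xI integral_if_stabilizes_ideal[OF less.hyps(1) x(1)] x(2) by blast
    then obtain w where w: "w \<in> lists (nonzero_primes R)" "word_prod w = J"
      using less.IH[OF J] \<open>I \<subseteq> J\<close> by blast
    have "P \<cdot>\<^bsub>R\<^esub> J = I"
    proof
      show "P \<cdot>\<^bsub>R\<^esub> J \<subseteq> I" by (rule ideal_prod_subset[OF I]) (auto simp: J_def mult.commute)
      \<comment> \<open>Some \<open>x * a\<close> leaves \<open>P\<close> and is invertible modulo
        \<open>P\<close>; multiplying \<open>1 = e + r * (x * a)\<close> by \<open>z\<close> writes
        \<open>z\<close> as a sum of two products from \<open>P\<close> and
        \<open>J\<close>.\<close>
      obtain a where a: "a \<in> P" "x * a \<notin> P"
        using integral_if_stabilizes_ideal[OF nzP x(1)] x(2) by blast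
      obtain e r where e: "e \<in> P" "r \<in> \<O>" "1 = e + r * (x * a)"
        using prime_inverse_mod[OF P(1) x(3)[OF a(1)] a(2)] by blast
      show "I \<subseteq> P \<cdot>\<^bsub>R\<^esub> J"
      proof
        fix z assume z: "z \<in> I"
        have "r * (x * z) \<in> J" using idealD(4)[OF J e(2) xI[OF z]] .
        then have "e * z + a * (r * (x * z)) \<in> P \<cdot>\<^bsub>R\<^esub> J"
          using ideal_prod.sum[OF ideal_prod.prod[of e P z J R] ideal_prod.prod[of a P "r * (x * z)" J R]]
            e(1) a(1) z \<open>I \<subseteq> J\<close> by auto
        moreover have "e * z + a * (r * (x * z)) = (e + r * (x * a)) * z" by (simp add: algebra_simps)
        ultimately show "z \<in> P \<cdot>\<^bsub>R\<^esub> J" by (simp flip: e(3))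
      qed
    qed
    then show ?thesis using w P(1) by (intro bexI[of _ "P # w"]) auto
  qed
qed

end

section \<open>The ghost algebra and Witt vectors\<close>

text \<open>Such a function descends to the finitely many keys. This proves finiteness both for the
  powers of one prime and for the whole orbit.\<close>

lemma finite_functions_of_finite_key:
  fixes k :: "'i \<Rightarrow> 'k" and V :: "('i \<Rightarrow> 'c) set"
  assumes "finite (k ` D)" "finite C"
    and "\<And>v. v \<in> V \<Longrightarrow> v \<in> D \<rightarrow>\<^sub>E C"
    and "\<And>v x y. v \<in> V \<Longrightarrow> x \<in> D \<Longrightarrow> y \<in> D \<Longrightarrow> k x = k y \<Longrightarrow> v x = v y"
  shows "finite V"
proof (rule finite_imageD)
  define \<phi> where "\<phi> v = (\<lambda>t\<in>k ` D. v (inv_into D k t))" for v :: "'i \<Rightarrow> 'c"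
  have "\<phi> ` V \<subseteq> k ` D \<rightarrow>\<^sub>E C"
    using assms(3) by (auto simp: \<phi>_def PiE_iff inv_into_into)
  then show "finite (\<phi> ` V)" using assms(1,2) by (meson finite_PiE finite_subset)
  show "inj_on \<phi> V"
  proof (rule inj_onI)
    fix v w assume vw: "v \<in> V" "w \<in> V" "\<phi> v = \<phi> w"
    show "v = w"
    proof (rule PiE_ext[OF assms(3)[OF vw(1)] assms(3)[OF vw(2)]])
      fix x assume x: "x \<in> D"
      let ?y = "inv_into D k (k x)"
      have y: "?y \<in> D" "k x = k ?y" using x by (auto simp: inv_into_into f_inv_into_f)
      have "v ?y = w ?y" using fun_cong[OF vw(3), of "k x"] x by (simp add: \<phi>_def)
      then show "v x = w x" using assms(4)[OF vw(1) x y] assms(4)[OF vw(2) x y] by simp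
    qed
  qed
qed

section \<open>The ghost algebra as a ring of functions\<close>

locale integers_extension = number_field_integers K + L: number_field_integers L
  for K L :: "'a::field_char_0 set" +
  assumes subset: "K \<subseteq> L"
begin

abbreviation "NI \<equiv> nonzero_ideals R"
abbreviation "A \<equiv> algebra_of_integers L"
abbreviation "G \<equiv> ghost_algebra R A"
abbreviation "\<O>L \<equiv> int_ring L"

lemma int_ring_subset: "\<O> \<subseteq> \<O>L"
  using subset by (auto simp: int_ring_def)

lemma int_ring_descend: "x \<in> K \<Longrightarrow> x \<in> \<O>L \<Longrightarrow> x \<in> \<O>"
  by (simp add: int_ring_def)

lemma ghost_simps [simp]:
  "carrier G = NI \<rightarrow>\<^sub>E \<O>L"
  "f \<oplus>\<^bsub>G\<^esub> g = (\<lambda>I\<in>NI. f I + g I)"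
  "f \<otimes>\<^bsub>G\<^esub> g = (\<lambda>I\<in>NI. f I * g I)"
  "c \<odot>\<^bsub>G\<^esub> f = (\<lambda>I\<in>NI. c * f I)"
  "\<zero>\<^bsub>G\<^esub> = (\<lambda>I\<in>NI. 0)"
  "\<one>\<^bsub>G\<^esub> = (\<lambda>I\<in>NI. 1)"
  by (simp_all add: ghost_algebra_def algebra_of_integers_def int_ring_def)

lemma cring_G: "cring G"
proof (rule cringI)
  show "abelian_group G"
  proof (rule abelian_groupI)
    fix f assume f: "f \<in> carrier G"
    show "\<exists>g\<in>carrier G. g \<oplus>\<^bsub>G\<^esub> f = \<zero>\<^bsub>G\<^esub>"
      using f by (intro bexI[of _ "\<lambda>I\<in>NI. - f I"]) (auto simp: PiE_iff intro: L.int_ring_uminus)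
  qed (auto simp: PiE_iff extensional_def fun_eq_iff L.int_ring_intros)
  show "comm_monoid G"
    by (rule comm_monoidI) (auto simp: PiE_iff extensional_def fun_eq_iff L.int_ring_intros)
qed (auto simp: fun_eq_iff distrib_right)

sublocale G: cring G
  by (rule cring_G)

lemma module_G: "Module.module R G"
  by (rule Module.moduleI[OF cring_R G.is_abelian_group])
     (use int_ring_subset in \<open>auto simp: PiE_iff extensional_def fun_eq_iff algebra_simps L.int_ring_mult\<close>)

lemma a_inv_G: "f \<in> carrier G \<Longrightarrow> \<ominus>\<^bsub>G\<^esub> f = (\<lambda>I\<in>NI. - f I)"
  by (rule G.minus_equality) (auto simp: PiE_iff intro: L.int_ring_uminus)

lemma pow_G: "f \<in> carrier G \<Longrightarrow> I \<in> NI \<Longrightarrow> (f [^]\<^bsub>G\<^esub> (n::nat)) I = f I ^ n"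
  by (induction n) (auto simp: mult.commute)

lemma finsum_G:
  assumes "finite F" "\<And>i. i \<in> F \<Longrightarrow> f i \<in> carrier G" "I \<in> NI"
  shows "(\<Oplus>\<^bsub>G\<^esub>i\<in>F. f i) I = (\<Sum>i\<in>F. f i I)"
  using assms
proof (induction F)
  case (insert i F)
  then have "(\<Oplus>\<^bsub>G\<^esub>i\<in>insert i F. f i) = f i \<oplus>\<^bsub>G\<^esub> (\<Oplus>\<^bsub>G\<^esub>i\<in>F. f i)"
    by (intro G.finsum_insert) auto
  then show ?case using insert by simp
qed simp

text \<open>The generated submodule is an intersection, and the vectors satisfying \<open>Q\<close>
  form one of the submodules intersected. The operations are written out componentwise so that the
  cases speak about values.\<close>

lemma ideal_smult_G_induct [consumes 1, case_names zero uminus add smult gen]: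
  assumes \<eta>: "\<eta> \<in> ideal_smult R G P U"
    and "Q (\<lambda>I\<in>NI. 0)"
    and "\<And>f. f \<in> carrier G \<Longrightarrow> Q f \<Longrightarrow> Q (\<lambda>I\<in>NI. - f I)"
    and "\<And>f g. f \<in> carrier G \<Longrightarrow> g \<in> carrier G \<Longrightarrow> Q f \<Longrightarrow> Q g \<Longrightarrow> Q (\<lambda>I\<in>NI. f I + g I)"
    and "\<And>c f. c \<in> \<O> \<Longrightarrow> f \<in> carrier G \<Longrightarrow> Q f \<Longrightarrow> Q (\<lambda>I\<in>NI. c * f I)"
    and gen: "\<And>r f. r \<in> P \<Longrightarrow> f \<in> U \<Longrightarrow> Q (\<lambda>I\<in>NI. r * f I)"
    and P: "P \<subseteq> \<O>" and U: "U \<subseteq> carrier G"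
  shows "Q \<eta>" "\<eta> \<in> carrier G"
proof -
  interpret M: Module.module R G by (rule module_G)
  have "submodule {f \<in> carrier G. Q f} R G"
  proof (rule M.submoduleI)
    show "\<zero>\<^bsub>G\<^esub> \<in> {f \<in> carrier G. Q f}" using assms(2) G.zero_closed by simp
  next
    fix f assume "f \<in> {f \<in> carrier G. Q f}"
    then show "\<ominus>\<^bsub>G\<^esub> f \<in> {f \<in> carrier G. Q f}"
      using assms(3) G.a_inv_closed[of f] by (simp add: a_inv_G)
  next
    fix f g assume "f \<in> {f \<in> carrier G. Q f}" "g \<in> {f \<in> carrier G. Q f}"
    then show "f \<oplus>\<^bsub>G\<^esub> g \<in> {f \<in> carrier G. Q f}"
      using assms(4) G.a_closed[of f g] by simp
  next
    fix c f assume "c \<in> carrier R" "f \<in> {f \<in> carrier G. Q f}"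
    then show "c \<odot>\<^bsub>G\<^esub> f \<in> {f \<in> carrier G. Q f}"
      using assms(5) M.smult_closed[of c f] by simp
  qed auto
  moreover have "{r \<odot>\<^bsub>G\<^esub> f |r f. r \<in> P \<and> f \<in> U} \<subseteq> {f \<in> carrier G. Q f}"
  proof clarify
    fix r f assume "r \<in> P" "f \<in> U"
    then show "r \<odot>\<^bsub>G\<^esub> f \<in> carrier G \<and> Q (r \<odot>\<^bsub>G\<^esub> f)"
      using gen[of r f] P U M.smult_closed[of r f] by auto
  qed
  ultimately have "\<eta> \<in> {f \<in> carrier G. Q f}"
    using \<eta> unfolding ideal_smult_def submodule_generated_def by blast
  then show "Q \<eta>" "\<eta> \<in> carrier G" by auto
qed

lemma shift_apply: "J \<in> NI \<Longrightarrow> shift R I f J = f (I \<cdot>\<^bsub>R\<^esub> J)"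
  by (simp add: shift_def)

lemma witt_stage_carrier: "witt_stage R A n \<subseteq> carrier G"
  by (induction n) (auto simp del: ghost_simps)

lemma witt_stage_SucE:
  assumes "\<zeta> \<in> witt_stage R A (Suc n)" "P \<in> nonzero_primes R"
  obtains \<eta> where "\<eta> \<in> ideal_smult R G P (witt_stage R A n)"
    "\<And>I. I \<in> NI \<Longrightarrow> \<zeta> (P \<cdot>\<^bsub>R\<^esub> I) = \<zeta> I ^ residue_card R P + \<eta> I"
proof
  let ?\<eta> = "shift R P \<zeta> \<ominus>\<^bsub>G\<^esub> (\<zeta> [^]\<^bsub>G\<^esub> residue_card R P)"
  show "?\<eta> \<in> ideal_smult R G P (witt_stage R A n)"
    using assms by simp
  fix I assume I: "I \<in> NI"
  have \<zeta>: "\<zeta> \<in> carrier G" using assms(1) witt_stage_carrier by blast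
  then have "\<zeta> [^]\<^bsub>G\<^esub> residue_card R P \<in> carrier G" by (rule G.nat_pow_closed)
  from a_inv_G[OF this] have "?\<eta> I = \<zeta> (P \<cdot>\<^bsub>R\<^esub> I) - \<zeta> I ^ residue_card R P"
    using I by (simp add: a_minus_def shift_apply pow_G[OF \<zeta>])
  then show "\<zeta> (P \<cdot>\<^bsub>R\<^esub> I) = \<zeta> I ^ residue_card R P + ?\<eta> I" by simp
qed

text \<open>When \<open>x P \<subseteq> \<O>\<close>, the set \<open>den_ideal x j\<close> plays the role of \<open>P\<^sup>j \<O>L\<close>: it is an ideal of \<open>\<O>L\<close>
  with \<open>P (den_ideal x j) \<subseteq> den_ideal x (j + 1)\<close>.\<close>

definition den_ideal :: "'a \<Rightarrow> nat \<Rightarrow> 'a set" where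
  "den_ideal x j = {y. \<forall>i\<le>j. x ^ i * y \<in> \<O>L}"

lemma den_ideal_0 [simp]: "den_ideal x 0 = \<O>L"
  by (simp add: den_ideal_def)

lemma den_ideal_subset: "den_ideal x j \<subseteq> \<O>L"
  by (force simp: den_ideal_def)

lemma den_ideal_antimono: "i \<le> j \<Longrightarrow> den_ideal x j \<subseteq> den_ideal x i"
  by (auto simp: den_ideal_def)

lemma den_ideal_zero: "0 \<in> den_ideal x j"
  by (simp add: den_ideal_def L.int_ring_0)

lemma den_ideal_add: "y \<in> den_ideal x j \<Longrightarrow> z \<in> den_ideal x j \<Longrightarrow> y + z \<in> den_ideal x j"
  by (simp add: den_ideal_def distrib_left L.int_ring_add)

lemma den_ideal_uminus: "y \<in> den_ideal x j \<Longrightarrow> - y \<in> den_ideal x j"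
  using L.int_ring_uminus by (fastforce simp: den_ideal_def)

lemma den_ideal_mult: "a \<in> \<O>L \<Longrightarrow> y \<in> den_ideal x j \<Longrightarrow> a * y \<in> den_ideal x j"
  by (simp add: den_ideal_def mult.left_commute[of _ a] L.int_ring_mult)

lemma den_ideal_Suc:
  assumes "r \<in> \<O>" "x * r \<in> \<O>" "y \<in> den_ideal x j"
  shows "r * y \<in> den_ideal x (Suc j)"
  unfolding den_ideal_def
proof (intro CollectI allI impI)
  fix i assume "i \<le> Suc j"
  show "x ^ i * (r * y) \<in> \<O>L"
  proof (cases i)
    case 0
    then show ?thesis using assms(1,3) den_ideal_subset int_ring_subset L.int_ring_mult by fastforce
  next
    case (Suc i')
    then have "x ^ i' * y \<in> \<O>L" using assms(3) \<open>i \<le> Suc j\<close> by (simp add: den_ideal_def)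
    then have "(x * r) * (x ^ i' * y) \<in> \<O>L" using assms(2) int_ring_subset L.int_ring_mult by blast
    then show ?thesis by (simp add: Suc mult_ac)
  qed
qed

lemma den_ideal_power_diff:
  assumes "a \<in> \<O>L" "b \<in> \<O>L" "a - b \<in> den_ideal x j"
  shows "a ^ q - b ^ q \<in> den_ideal x j"
proof (induction q)
  case (Suc q)
  have "a * (a ^ q - b ^ q) + b ^ q * (a - b) \<in> den_ideal x j"
    using Suc assms L.int_ring_power by (intro den_ideal_add den_ideal_mult) auto
  then show ?case by (simp add: algebra_simps)
qed (simp add: den_ideal_zero)

text \<open>Applied to a positive integer \<open>n\<close> in \<open>P\<close>, this carries
  finiteness of the residues modulo \<open>n ^ j\<close> over to
  \<open>den_ideal x j\<close>.\<close>

lemma den_ideal_multiple: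
  assumes "of_nat n \<in> \<O>" "x * of_nat n \<in> \<O>" "y \<in> \<O>L"
  shows "of_nat (n ^ j) * y \<in> den_ideal x j"
proof (induction j)
  case (Suc j)
  then show ?case using den_ideal_Suc[OF assms(1,2), of "of_nat (n ^ j) * y"] by (simp add: mult.assoc)
qed (simp add: assms)

text \<open>An analogue of the Krull intersection theorem: a nonzero \<open>d\<close> in every
  \<open>den_ideal x j\<close> is a common denominator of all powers of \<open>x\<close>, which
  would make \<open>x\<close> integral. The filtration decreases, so one \<open>j\<close> serves all
  of \<open>D\<close>.\<close>

lemma den_ideal_separated:
  assumes x: "x \<in> K" "x \<notin> \<O>" and D: "finite D" "D \<subseteq> \<O>L" "0 \<notin> D"
  shows "\<exists>j. D \<inter> den_ideal x j = {}"
proof -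
  have "\<exists>j. d \<notin> den_ideal x j" if d: "d \<in> D" for d
  proof (rule ccontr)
    assume "\<nexists>j. d \<notin> den_ideal x j"
    then have "d * x ^ j \<in> \<O>L" for j by (auto simp: den_ideal_def mult.commute)
    then have "x \<in> \<O>L"
      using L.almost_integral[of x d] x(1) subset D d by blast
    then show False using int_ring_descend x by blast
  qed
  then obtain j where j: "\<And>d. d \<in> D \<Longrightarrow> d \<notin> den_ideal x (j d)" by metis
  have "d \<notin> den_ideal x (Max (j ` D))" if "d \<in> D" for d
    using j[OF that] den_ideal_antimono[of "j d" "Max (j ` D)" x] D(1) that by auto
  then show ?thesis by blast
qed

text \<open>The key \<open>k\<close> encodes a finite partition of the set of ideals.\<close>

definition finite_shift_pattern :: "'a set \<Rightarrow> 'a \<Rightarrow> nat \<Rightarrow> ('a set \<Rightarrow> 'a) \<Rightarrow> bool" where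
  "finite_shift_pattern P x j f \<longleftrightarrow> (\<exists>k :: 'a set \<Rightarrow> nat. finite (k ` NI) \<and>
     (\<forall>I\<in>NI. \<forall>J\<in>NI. k I = k J \<longrightarrow>
        (\<forall>n. f (((\<lambda>M. P \<cdot>\<^bsub>R\<^esub> M) ^^ n) I) - f (((\<lambda>M. P \<cdot>\<^bsub>R\<^esub> M) ^^ n) J) \<in> den_ideal x j)))"

lemma iterated_mult_nonzero: "P \<in> NI \<Longrightarrow> I \<in> NI \<Longrightarrow> ((\<lambda>M. P \<cdot>\<^bsub>R\<^esub> M) ^^ n) I \<in> NI"
  by (induction n) (auto intro: ideal_prod_nonzero)

lemma finite_shift_pattern_add:
  assumes P: "P \<in> NI" and f: "finite_shift_pattern P x j f" and g: "finite_shift_pattern P x j g"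
  shows "finite_shift_pattern P x j (\<lambda>I\<in>NI. f I + g I)"
proof -
  let ?pw = "\<lambda>n. (\<lambda>M. P \<cdot>\<^bsub>R\<^esub> M) ^^ n"
  obtain k where k: "finite (k ` NI)" "\<And>I J n. I \<in> NI \<Longrightarrow> J \<in> NI \<Longrightarrow> k I = (k J :: nat) \<Longrightarrow>
      f (?pw n I) - f (?pw n J) \<in> den_ideal x j"
    using f unfolding finite_shift_pattern_def by blast
  obtain l where l: "finite (l ` NI)" "\<And>I J n. I \<in> NI \<Longrightarrow> J \<in> NI \<Longrightarrow> l I = (l J :: nat) \<Longrightarrow>
      g (?pw n I) - g (?pw n J) \<in> den_ideal x j"
    using g unfolding finite_shift_pattern_def by blast
  show ?thesis
    unfolding finite_shift_pattern_def
  proof (intro exI conjI ballI impI allI)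
    \<comment> \<open>Pairing the keys gives the common refinement of the two partitions.\<close>
    show "finite ((\<lambda>I. prod_encode (k I, l I)) ` NI)"
      by (rule finite_subset[of _ "prod_encode ` (k ` NI \<times> l ` NI)"]) (use k(1) l(1) in auto)
    fix I J n assume IJ: "I \<in> NI" "J \<in> NI" "prod_encode (k I, l I) = prod_encode (k J, l J)"
    then have "(f (?pw n I) - f (?pw n J)) + (g (?pw n I) - g (?pw n J)) \<in> den_ideal x j"
      using k(2) l(2) by (intro den_ideal_add) (auto simp: prod_encode_eq)
    then show "(\<lambda>I\<in>NI. f I + g I) (?pw n I) - (\<lambda>I\<in>NI. f I + g I) (?pw n J) \<in> den_ideal x j"
      using IJ iterated_mult_nonzero[OF P] by (simp add: algebra_simps)
  qed
qed

text \<open>Two exponents occur because a scalar from \<open>\<O>\<close> keeps the exponent, while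
  a factor from \<open>P\<close> raises it by one.\<close>

lemma finite_shift_pattern_mult:
  assumes P: "P \<in> NI" and f: "finite_shift_pattern P x i f"
    and c: "\<And>y. y \<in> den_ideal x i \<Longrightarrow> c * y \<in> den_ideal x j"
  shows "finite_shift_pattern P x j (\<lambda>I\<in>NI. c * f I)"
proof -
  let ?pw = "\<lambda>n. (\<lambda>M. P \<cdot>\<^bsub>R\<^esub> M) ^^ n"
  obtain k where k: "finite (k ` NI)" "\<And>I J n. I \<in> NI \<Longrightarrow> J \<in> NI \<Longrightarrow> k I = (k J :: nat) \<Longrightarrow>
      f (?pw n I) - f (?pw n J) \<in> den_ideal x i"
    using f unfolding finite_shift_pattern_def by blast
  have "c * f (?pw n I) - c * f (?pw n J) \<in> den_ideal x j" if "I \<in> NI" "J \<in> NI" "k I = k J" for I J n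
    using c[OF k(2)[OF that]] by (simp add: right_diff_distrib)
  then show ?thesis
    unfolding finite_shift_pattern_def using k(1) iterated_mult_nonzero[OF P] by (intro exI[of _ k]) auto
qed

text \<open>The recursion \<open>\<zeta> (P I) = (\<zeta> I)\<^sup>q + \<eta> I\<close> determines the \<open>P\<close>-shifts of \<open>\<zeta>\<close> from \<open>\<zeta>\<close> and those of \<open>\<eta>\<close>,
  and \<open>\<eta>\<close> is a combination, with coefficients in \<open>P\<close>, of elements of the previous stage.\<close>

lemma witt_stage_finite_shift_pattern:
  assumes P: "P \<in> nonzero_primes R" and x: "x \<in> K" "\<And>c. c \<in> P \<Longrightarrow> x * c \<in> \<O>"
  shows "\<zeta> \<in> witt_stage R A j \<Longrightarrow> finite_shift_pattern P x j \<zeta>"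
proof (induction j arbitrary: \<zeta>)
  case 0
  then have "\<zeta> I \<in> \<O>L" if "I \<in> NI" for I using that by (auto simp: PiE_iff)
  then show ?case
    unfolding finite_shift_pattern_def using iterated_mult_nonzero nonzero_prime_imp_ideal[OF P]
    by (intro exI[of _ "\<lambda>_. 0"]) (auto intro!: L.int_ring_diff simp: image_constant_conv)
next
  case (Suc j)
  let ?pw = "\<lambda>n. (\<lambda>M. P \<cdot>\<^bsub>R\<^esub> M) ^^ n"
  have nz: "P \<in> NI" and PO: "P \<subseteq> \<O>"
    using P nonzero_prime_imp_ideal nonzero_idealD idealD(1) by blast+
  obtain \<eta> where \<eta>: "\<eta> \<in> ideal_smult R G P (witt_stage R A j)"
    and rec: "\<And>I. I \<in> NI \<Longrightarrow> \<zeta> (P \<cdot>\<^bsub>R\<^esub> I) = \<zeta> I ^ residue_card R P + \<eta> I"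
    using witt_stage_SucE[OF Suc.prems P] by blast
  have "\<zeta> \<in> carrier G" using Suc.prems witt_stage_carrier by blast
  then have \<zeta>: "\<zeta> I \<in> \<O>L" if "I \<in> NI" for I using that by (auto simp: PiE_iff)
  have "finite_shift_pattern P x (Suc j) \<eta>"
    using \<eta>
  proof (induction rule: ideal_smult_G_induct(1))
    case zero
    show ?case unfolding finite_shift_pattern_def
      using iterated_mult_nonzero[OF nz] by (intro exI[of _ "\<lambda>_. 0"]) (auto simp: den_ideal_zero image_constant_conv)
  next
    case (uminus f)
    have "finite_shift_pattern P x (Suc j) (\<lambda>I\<in>NI. (-1) * f I)"
      using uminus(2) by (rule finite_shift_pattern_mult[OF nz]) (simp add: den_ideal_uminus)
    then show ?case by (simp only: mult_minus1)
  next
    case (smult c f)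
    then show ?case
      using int_ring_subset by (intro finite_shift_pattern_mult[OF nz, of x "Suc j"] den_ideal_mult) auto
  next
    \<comment> \<open>Here the exponent grows: the outer induction controls \<open>f\<close> modulo
      \<open>den_ideal x j\<close>, and the factor \<open>r\<close> from \<open>P\<close> gains one
      step.\<close>
    case (gen r f)
    then show ?case
      using x(2) PO Suc.IH by (intro finite_shift_pattern_mult[OF nz, of x j] den_ideal_Suc) auto
  next
    case (add f g)
    show ?case by (rule finite_shift_pattern_add[OF nz add(3,4)])
  qed (use PO witt_stage_carrier in auto)
  then obtain k where k: "finite (k ` NI)" "\<And>I J n. I \<in> NI \<Longrightarrow> J \<in> NI \<Longrightarrow> k I = (k J :: nat) \<Longrightarrow>
      \<eta> (?pw n I) - \<eta> (?pw n J) \<in> den_ideal x (Suc j)"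
    unfolding finite_shift_pattern_def by blast
  \<comment> \<open>Because \<open>m\<close> lies in \<open>P\<close>, congruence modulo
    \<open>m ^ Suc j\<close> implies congruence modulo \<open>den_ideal x (Suc j)\<close>.\<close>
  obtain m where m: "m > 0" "of_nat m \<in> P" using nonzero_ideal_nat[OF nz] by blast
  obtain \<rho> where \<rho>: "finite (\<rho> ` \<O>L)" "\<rho> ` \<O>L \<subseteq> \<O>L"
    "\<And>y. y \<in> \<O>L \<Longrightarrow> \<exists>w\<in>\<O>L. y = \<rho> y + of_nat (m ^ Suc j) * w"
    using L.residue_map[of "m ^ Suc j"] m(1) by auto
  have \<rho>_eq: "y - z \<in> den_ideal x (Suc j)" if yz: "y \<in> \<O>L" "z \<in> \<O>L" "\<rho> y = \<rho> z" for y z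
  proof -
    obtain s u v where uv: "u \<in> \<O>L" "v \<in> \<O>L" "y = s + of_nat (m ^ Suc j) * u" "z = s + of_nat (m ^ Suc j) * v"
      using \<rho>(3)[OF yz(1)] \<rho>(3)[OF yz(2)] yz(3) by metis
    then have "y - z = of_nat (m ^ Suc j) * (u - v)" by (simp only: uv(3,4) add_diff_cancel_left right_diff_distrib)
    moreover have "of_nat (m ^ Suc j) * (u - v) \<in> den_ideal x (Suc j)"
      using m(2) x(2) PO uv(1,2) by (intro den_ideal_multiple L.int_ring_diff) auto
    ultimately show ?thesis by simp
  qed
  obtain h :: "'a \<Rightarrow> nat" where h: "inj_on h (\<rho> ` \<O>L)"
    using finite_imp_inj_to_nat_seg[OF \<rho>(1)] by blast
  show ?case
    unfolding finite_shift_pattern_def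
  proof (intro exI conjI ballI impI)
    \<comment> \<open>The key pairs a residue of the value at \<open>I\<close>, which starts the
      recursion, with the key for \<eta>, which controls all later steps.\<close>
    let ?k = "\<lambda>I. prod_encode (h (\<rho> (\<zeta> I)), k I)"
    show "finite (?k ` NI)"
    proof (rule finite_subset)
      show "?k ` NI \<subseteq> prod_encode ` (h ` \<rho> ` \<O>L \<times> k ` NI)" using \<zeta> by blast
      show "finite (prod_encode ` (h ` \<rho> ` \<O>L \<times> k ` NI))" using k(1) \<rho>(1) by simp
    qed
    fix I J assume IJ: "I \<in> NI" "J \<in> NI" "?k I = ?k J"
    then have eq: "\<rho> (\<zeta> I) = \<rho> (\<zeta> J)" "k I = k J"
      using inj_onD[OF h, of "\<rho> (\<zeta> I)" "\<rho> (\<zeta> J)"] \<zeta> by (simp_all add: prod_encode_eq)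
    show "\<forall>n. \<zeta> (?pw n I) - \<zeta> (?pw n J) \<in> den_ideal x (Suc j)"
    proof
      fix n
      show "\<zeta> (?pw n I) - \<zeta> (?pw n J) \<in> den_ideal x (Suc j)"
      proof (induction n)
        case 0
        show ?case using \<rho>_eq[OF \<zeta>[OF IJ(1)] \<zeta>[OF IJ(2)] eq(1)] by simp
      next
        case (Suc n)
        let ?q = "residue_card R P"
        note pw = iterated_mult_nonzero[OF nz IJ(1), of n] iterated_mult_nonzero[OF nz IJ(2), of n]
        have "(\<zeta> (?pw n I) ^ ?q - \<zeta> (?pw n J) ^ ?q) + (\<eta> (?pw n I) - \<eta> (?pw n J)) \<in> den_ideal x (Suc j)"
          using Suc.IH pw \<zeta> k(2)[OF IJ(1,2) eq(2)] by (intro den_ideal_add den_ideal_power_diff) auto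
        then show ?case using rec[OF pw(1)] rec[OF pw(2)] by (simp add: algebra_simps)
      qed
    qed
  qed
qed

end

section \<open>Finiteness of the orbit\<close>

context integers_extension
begin

lemma coefficients_subset: "f \<in> carrier G \<Longrightarrow> coefficients R f \<subseteq> \<O>L"
  by (auto simp: coefficients_def PiE_iff)

lemma ex_prime_separating_stage:
  assumes P: "P \<in> nonzero_primes R" and C: "finite C" "C \<subseteq> \<O>L"
    and x: "x \<in> K" "x \<notin> \<O>"
  shows "\<exists>j. \<forall>c\<in>C. \<forall>d\<in>C. c - d \<in> den_ideal x j \<longrightarrow> c = d"
proof -
  define D where "D = (\<lambda>(c, d). c - d) ` (C \<times> C) - {0}"
  have "finite D" "D \<subseteq> \<O>L" "0 \<notin> D" using C by (auto simp: D_def intro: L.int_ring_diff)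
  then obtain j where j: "D \<inter> den_ideal x j = {}" using den_ideal_separated[OF x] by blast
  have "c = d" if "c \<in> C" "d \<in> C" "c - d \<in> den_ideal x j" for c d
  proof (rule ccontr)
    assume "c \<noteq> d"
    then have "c - d \<in> D" using that(1,2) by (auto simp: D_def)
    then show False using j that(3) by blast
  qed
  then show ?thesis by blast
qed

text \<open>At a separating exponent the congruences become equalities, so every
  \<open>P\<close>-power shift is constant on the parts of one finite partition.\<close>

lemma finite_prime_power_shifts:
  assumes \<xi>: "\<xi> \<in> witt_vectors R A" and C: "finite (coefficients R \<xi>)" and P: "P \<in> nonzero_primes R"
  shows "finite (range (\<lambda>n. \<lambda>I\<in>NI. \<xi> (((\<lambda>M. P \<cdot>\<^bsub>R\<^esub> M) ^^ n) I)))"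
proof -
  let ?pw = "\<lambda>n. (\<lambda>M. P \<cdot>\<^bsub>R\<^esub> M) ^^ n"
  have stage: "\<xi> \<in> witt_stage R A j" for j using \<xi> by (simp add: witt_vectors_def)
  obtain x where x: "x \<in> K" "x \<notin> \<O>" "\<And>c. c \<in> P \<Longrightarrow> x * c \<in> \<O>"
    using ex_prime_denominator[OF P] by blast
  have "coefficients R \<xi> \<subseteq> \<O>L" using stage witt_stage_carrier coefficients_subset by blast
  then obtain j where j: "\<forall>c\<in>coefficients R \<xi>. \<forall>d\<in>coefficients R \<xi>. c - d \<in> den_ideal x j \<longrightarrow> c = d"
    using ex_prime_separating_stage[OF P C _ x(1,2)] by blast
  have "finite_shift_pattern P x j \<xi>"
    by (rule witt_stage_finite_shift_pattern[OF P x(1,3) stage])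
  then obtain k where k: "finite (k ` NI)" "\<And>I J n. I \<in> NI \<Longrightarrow> J \<in> NI \<Longrightarrow> k I = (k J :: nat) \<Longrightarrow>
      \<xi> (?pw n I) - \<xi> (?pw n J) \<in> den_ideal x j"
    unfolding finite_shift_pattern_def by blast
  have mem: "\<xi> (?pw n I) \<in> coefficients R \<xi>" if "I \<in> NI" for n I
    using iterated_mult_nonzero[OF nonzero_prime_imp_ideal[OF P] that] by (auto simp: coefficients_def)
  show ?thesis
  proof (rule finite_functions_of_finite_key[OF k(1) C])
    fix v assume "v \<in> range (\<lambda>n. \<lambda>I\<in>NI. \<xi> (?pw n I))"
    then obtain n where v: "v = (\<lambda>I\<in>NI. \<xi> (?pw n I))" by blast
    show "v \<in> NI \<rightarrow>\<^sub>E coefficients R \<xi>" unfolding v using mem by auto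
    fix I J assume IJ: "I \<in> NI" "J \<in> NI" "k I = k J"
    then show "v I = v J" using j k(2)[OF IJ] mem by (simp add: v)
  qed
qed

lemma iterated_mult_commute:
  assumes "P \<in> NI" "I \<in> NI" "J \<in> NI"
  shows "J \<cdot>\<^bsub>R\<^esub> ((\<lambda>M. P \<cdot>\<^bsub>R\<^esub> M) ^^ n) I = ((\<lambda>M. P \<cdot>\<^bsub>R\<^esub> M) ^^ n) (J \<cdot>\<^bsub>R\<^esub> I)"
proof (induction n)
  case (Suc n)
  have M: "((\<lambda>M. P \<cdot>\<^bsub>R\<^esub> M) ^^ n) I \<in> NI" by (rule iterated_mult_nonzero[OF assms(1,2)])
  have "J \<cdot>\<^bsub>R\<^esub> (P \<cdot>\<^bsub>R\<^esub> ((\<lambda>M. P \<cdot>\<^bsub>R\<^esub> M) ^^ n) I) = P \<cdot>\<^bsub>R\<^esub> (J \<cdot>\<^bsub>R\<^esub> ((\<lambda>M. P \<cdot>\<^bsub>R\<^esub> M) ^^ n) I)"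
    using ideal_mult_assoc[OF assms(3,1) M] ideal_mult_assoc[OF assms(1,3) M]
      ideal_mult_commute[OF assms(1,3)] by simp
  then show ?case using Suc.IH by simp
qed simp

text \<open>By commutativity the factors \<open>P\<close> can be collected. Multiplication by
  \<open>I\<close> is built into the identity so that the power of \<open>P\<close> appears as the
  iterate used in \<open>finite_shift_pattern\<close>.\<close>

lemma word_prod_insert_decompose:
  assumes P: "P \<in> NI" and S: "S \<subseteq> NI" and w: "w \<in> lists (insert P S)"
  shows "\<exists>n. \<exists>v\<in>lists S. \<forall>I\<in>NI. word_prod w \<cdot>\<^bsub>R\<^esub> I = word_prod v \<cdot>\<^bsub>R\<^esub> ((\<lambda>M. P \<cdot>\<^bsub>R\<^esub> M) ^^ n) I"
  using w
proof (induction w rule: list.induct)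
  case Nil
  show ?case by (intro exI[of _ 0] bexI[of _ "[]"]) auto
next
  case (Cons Q w)
  let ?pw = "\<lambda>n. (\<lambda>M. P \<cdot>\<^bsub>R\<^esub> M) ^^ n"
  obtain n v where v: "v \<in> lists S" "\<And>I. I \<in> NI \<Longrightarrow> word_prod w \<cdot>\<^bsub>R\<^esub> I = word_prod v \<cdot>\<^bsub>R\<^esub> ?pw n I"
    using Cons.IH Cons.prems by auto
  have Q: "Q \<in> NI" "w \<in> lists NI" "v \<in> lists NI" using Cons.prems P S v(1) by auto
  have step: "word_prod (Q # w) \<cdot>\<^bsub>R\<^esub> I = Q \<cdot>\<^bsub>R\<^esub> (word_prod v \<cdot>\<^bsub>R\<^esub> ?pw n I)" if "I \<in> NI" for I
    using that v(2)[OF that] Q by (simp add: ideal_mult_assoc word_prod_nonzero)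
  show ?case
  proof (cases "Q \<in> S")
    case True
    have "word_prod (Q # w) \<cdot>\<^bsub>R\<^esub> I = word_prod (Q # v) \<cdot>\<^bsub>R\<^esub> ?pw n I" if "I \<in> NI" for I
      using step[OF that] that Q iterated_mult_nonzero[OF P that]
      by (simp add: ideal_mult_assoc word_prod_nonzero)
    then show ?thesis using True v(1) by (intro exI[of _ n] bexI[of _ "Q # v"]) auto
  next
    case False
    then have QP: "Q = P" using Cons.prems by auto
    have "word_prod (Q # w) \<cdot>\<^bsub>R\<^esub> I = word_prod v \<cdot>\<^bsub>R\<^esub> ?pw (Suc n) I" if "I \<in> NI" for I
      using step[OF that] iterated_mult_commute[OF P that word_prod_nonzero[OF Q(3)], of n]
        iterated_mult_commute[OF P that word_prod_nonzero[OF Q(3)], of "Suc n"] QP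
      by simp
    then show ?thesis using v(1) by blast
  qed
qed

text \<open>Shifts commute, so finiteness of the orbit under each of finitely many primes gives finiteness
  of the orbit under the monoid that they generate.\<close>

lemma finite_word_shifts:
  assumes "finite S" "S \<subseteq> NI"
    and "\<And>P. P \<in> S \<Longrightarrow> finite (range (\<lambda>n. \<lambda>I\<in>NI. f (((\<lambda>M. P \<cdot>\<^bsub>R\<^esub> M) ^^ n) I)))"
  shows "finite {shift R (word_prod w) f |w. w \<in> lists S}"
  using assms
proof (induction S)
  case empty
  show ?case by simp
next
  case (insert P S)
  let ?pw = "\<lambda>n. (\<lambda>M. P \<cdot>\<^bsub>R\<^esub> M) ^^ n"
  define v where "v n = (\<lambda>I\<in>NI. f (?pw n I))" for n
  define E where "E = {shift R (word_prod w) f |w. w \<in> lists S}"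
  have P: "P \<in> NI" and S: "S \<subseteq> NI" using insert.prems by auto
  have E: "finite E" unfolding E_def using insert by auto
  have "finite (range v)" unfolding v_def by (rule insert.prems(2)) simp
  then obtain M where M: "finite M" "range v = v ` M"
    using finite_subset_image[of "range v" v UNIV] by auto
  have "shift R (word_prod w) f \<in> (\<lambda>(m, g). \<lambda>I\<in>NI. g (?pw m I)) ` (M \<times> E)"
    if w: "w \<in> lists (insert P S)" for w
  proof -
    obtain n u where u: "u \<in> lists S"
      "\<And>I. I \<in> NI \<Longrightarrow> word_prod w \<cdot>\<^bsub>R\<^esub> I = word_prod u \<cdot>\<^bsub>R\<^esub> ?pw n I"
      using word_prod_insert_decompose[OF P S w] by blast
    obtain m where m: "m \<in> M" "v n = v m" using M(2) by blast
    have U: "word_prod u \<in> NI" using u(1) S by (intro word_prod_nonzero) auto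
    have "f (word_prod w \<cdot>\<^bsub>R\<^esub> I) = f (word_prod u \<cdot>\<^bsub>R\<^esub> ?pw m I)" if I: "I \<in> NI" for I
    proof -
      have UI: "word_prod u \<cdot>\<^bsub>R\<^esub> I \<in> NI" by (rule ideal_prod_nonzero[OF U I])
      \<comment> \<open>Moving \<open>word_prod u\<close> inside the iterate exposes a value of
        \<open>v n\<close>, where the exponent can be exchanged.\<close>
      have "f (word_prod w \<cdot>\<^bsub>R\<^esub> I) = v n (word_prod u \<cdot>\<^bsub>R\<^esub> I)"
        using UI u(2)[OF I] iterated_mult_commute[OF P I U] by (simp add: v_def)
      also have "\<dots> = f (word_prod u \<cdot>\<^bsub>R\<^esub> ?pw m I)"
        using UI m(2) iterated_mult_commute[OF P I U] by (simp add: v_def)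
      finally show ?thesis .
    qed
    then have "shift R (word_prod w) f = (\<lambda>I\<in>NI. shift R (word_prod u) f (?pw m I))"
      using iterated_mult_nonzero[OF P] by (auto simp: shift_def fun_eq_iff)
    then show ?thesis using m(1) u(1) unfolding E_def by force
  qed
  then have "{shift R (word_prod w) f |w. w \<in> lists (insert P S)}
      \<subseteq> (\<lambda>(m, g). \<lambda>I\<in>NI. g (?pw m I)) ` (M \<times> E)" by blast
  then show ?case using M(1) E finite_subset by blast
qed

text \<open>If \<open>n\<close> were outside \<open>P\<close>, then \<open>1 = e + r * n\<close>
  with \<open>e\<close> in \<open>P\<close>, and \<open>x = x * e + r * (x * n)\<close> would be
  integral, since \<open>x * n = y * (x * d)\<close>.\<close>

lemma prime_contains_if_not_separated:
  assumes P: "P \<in> nonzero_primes R" and x: "x \<in> K" "x \<notin> \<O>" "\<And>c. c \<in> P \<Longrightarrow> x * c \<in> \<O>"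
    and d: "d \<in> den_ideal x 1" and y: "y \<in> \<O>L" "d * y = of_nat n"
  shows "of_nat n \<in> P"
proof (rule ccontr)
  assume n: "of_nat n \<notin> P"
  have "of_nat n \<in> \<O>" using int_ring_of_int[of "int n"] by simp
  then obtain e r where e: "e \<in> P" "r \<in> \<O>" "1 = e + r * of_nat n"
    using prime_inverse_mod[OF P _ n] by blast
  have "y * (x * d) \<in> \<O>L" using d y(1) L.int_ring_mult by (auto simp: den_ideal_def)
  then have "x * of_nat n \<in> \<O>L" by (simp add: mult_ac flip: y(2))
  moreover have "x * of_nat n \<in> K" using x(1) of_int_mem[of "int n"] mult_mem by simp
  ultimately have "x * of_nat n \<in> \<O>" by (rule int_ring_descend[rotated])
  then have "x * e + r * (x * of_nat n) \<in> \<O>" by (rule int_ring_add[OF x(3)[OF e(1)] int_ring_mult[OF e(2)]])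
  moreover have "x * e + r * (x * of_nat n) = x * (e + r * of_nat n)" by (simp add: algebra_simps)
  ultimately show False using x(2) by (simp flip: e(3))
qed

text \<open>Fix a positive integer multiple of each nonzero difference of coefficients. For a prime \<open>P\<close> that
  contains none of these integers, the congruence \<open>\<xi> (P I) \<equiv> (\<xi> I)\<^sup>q\<close> modulo \<open>P\<close> determines \<open>\<xi> (P I)\<close>
  from \<open>\<xi> I\<close>.\<close>

lemma finite_bad_primes:
  assumes \<xi>: "\<xi> \<in> witt_vectors R A" and C: "finite (coefficients R \<xi>)"
  obtains B where "finite B" "B \<subseteq> nonzero_primes R"
    "\<And>P I J. P \<in> nonzero_primes R - B \<Longrightarrow> I \<in> NI \<Longrightarrow> J \<in> NI \<Longrightarrow> \<xi> I = \<xi> J \<Longrightarrow>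
      \<xi> (P \<cdot>\<^bsub>R\<^esub> I) = \<xi> (P \<cdot>\<^bsub>R\<^esub> J)"
proof -
  have stage: "\<xi> \<in> witt_stage R A j" for j using \<xi> by (simp add: witt_vectors_def)
  have CL: "coefficients R \<xi> \<subseteq> \<O>L" using stage witt_stage_carrier coefficients_subset by blast
  define D where "D = (\<lambda>(c, d). c - d) ` (coefficients R \<xi> \<times> coefficients R \<xi>) - {0}"
  have D: "finite D" "d \<in> D \<Longrightarrow> d \<in> \<O>L \<and> d \<noteq> 0" for d
    using C CL by (auto simp: D_def intro: L.int_ring_diff)
  then have "\<forall>d\<in>D. \<exists>n>0. \<exists>y\<in>\<O>L. d * y = of_nat n" using L.ex_multiple_nat by blast
  then obtain n where n: "\<And>d. d \<in> D \<Longrightarrow> n d > 0 \<and> (\<exists>y\<in>\<O>L. d * y = of_nat (n d))" by metis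
  define B where "B = nonzero_primes R \<inter> (\<Union>d\<in>D. {J. ideal J R \<and> of_nat (n d) \<in> J})"
  show ?thesis
  proof
    show "finite B" unfolding B_def using D(1) n finite_ideals_containing by (intro finite_Int) auto
    show "B \<subseteq> nonzero_primes R" by (simp add: B_def)
    fix P I J assume P: "P \<in> nonzero_primes R - B" and IJ: "I \<in> NI" "J \<in> NI" "\<xi> I = \<xi> J"
    have P': "P \<in> nonzero_primes R" using P by simp
    have id: "ideal P R" and nz: "P \<in> NI" using P' nonzero_prime_imp_ideal nonzero_idealD by auto
    obtain x where x: "x \<in> K" "x \<notin> \<O>" "\<And>c. c \<in> P \<Longrightarrow> x * c \<in> \<O>"
      using ex_prime_denominator[OF P'] by blast
    obtain \<eta> where \<eta>: "\<eta> \<in> ideal_smult R G P (witt_stage R A 0)"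
      and rec: "\<And>I. I \<in> NI \<Longrightarrow> \<xi> (P \<cdot>\<^bsub>R\<^esub> I) = \<xi> I ^ residue_card R P + \<eta> I"
      using witt_stage_SucE[OF stage P'] by blast
    \<comment> \<open>One Witt condition is enough here, because every component of the error, not
      just a difference of two, is small.\<close>
    have "\<forall>I\<in>NI. \<eta> I \<in> den_ideal x 1"
      using \<eta>
    proof (induction rule: ideal_smult_G_induct(1))
      case (gen r f)
      then show ?case using x(3) idealD(1)[OF id] den_ideal_Suc[of r x _ 0] by (auto simp: PiE_iff)
    qed (use idealD(1)[OF id] int_ring_subset in
        \<open>auto simp: den_ideal_zero den_ideal_uminus den_ideal_add den_ideal_mult\<close>)
    then have "\<eta> I - \<eta> J \<in> den_ideal x 1"
      using IJ den_ideal_add[of "\<eta> I" x 1 "- \<eta> J"] den_ideal_uminus by simp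
    then have diff: "\<xi> (P \<cdot>\<^bsub>R\<^esub> I) - \<xi> (P \<cdot>\<^bsub>R\<^esub> J) \<in> den_ideal x 1"
      using rec IJ by simp
    show "\<xi> (P \<cdot>\<^bsub>R\<^esub> I) = \<xi> (P \<cdot>\<^bsub>R\<^esub> J)"
    proof (rule ccontr)
      assume "\<xi> (P \<cdot>\<^bsub>R\<^esub> I) \<noteq> \<xi> (P \<cdot>\<^bsub>R\<^esub> J)"
      moreover have "\<xi> (P \<cdot>\<^bsub>R\<^esub> M) \<in> coefficients R \<xi>" if "M \<in> NI" for M
        using ideal_prod_nonzero[OF nz that] by (auto simp: coefficients_def)
      ultimately have "\<xi> (P \<cdot>\<^bsub>R\<^esub> I) - \<xi> (P \<cdot>\<^bsub>R\<^esub> J) \<in> D"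
        using IJ(1,2) by (auto simp: D_def)
      then have "of_nat (n (\<xi> (P \<cdot>\<^bsub>R\<^esub> I) - \<xi> (P \<cdot>\<^bsub>R\<^esub> J))) \<in> P" "P \<in> B"
        using n prime_contains_if_not_separated[OF P' x diff] id P' unfolding B_def by blast+
      then show False using P by blast
    qed
  qed
qed

theorem finite_orbit_if_finite_coefficients:
  assumes \<xi>: "\<xi> \<in> witt_vectors R A" and C: "finite (coefficients R \<xi>)"
  shows "finite (shift_orbit R \<xi>)"
proof -
  obtain B where B: "finite B" "B \<subseteq> nonzero_primes R"
    and good: "\<And>P I J. P \<in> nonzero_primes R - B \<Longrightarrow> I \<in> NI \<Longrightarrow> J \<in> NI \<Longrightarrow> \<xi> I = \<xi> J \<Longrightarrow>
      \<xi> (P \<cdot>\<^bsub>R\<^esub> I) = \<xi> (P \<cdot>\<^bsub>R\<^esub> J)"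
    using finite_bad_primes[OF \<xi> C] by blast
  have BN: "B \<subseteq> NI" using B(2) nonzero_prime_imp_ideal by blast
  define E where "E = {shift R (word_prod v) \<xi> |v. v \<in> lists B}"
  have E: "finite E"
    unfolding E_def using B finite_prime_power_shifts[OF \<xi> C] BN by (intro finite_word_shifts) auto
  \<comment> \<open>The key of \<open>I\<close> lists the values at \<open>I\<close> of the finitely
    many shifts by products of bad primes.\<close>
  define k where "k I = (\<lambda>g\<in>E. g I)" for I
  have orbit: "g \<in> NI \<rightarrow>\<^sub>E coefficients R \<xi>" if g: "g \<in> shift_orbit R \<xi>" for g
  proof -
    obtain M where M: "M \<in> NI" "g = shift R M \<xi>" using g unfolding shift_orbit_def by blast
    then show ?thesis
      unfolding M(2) coefficients_def shift_def restrict_PiE_iff using ideal_prod_nonzero by blast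
  qed
  have E_orbit: "E \<subseteq> shift_orbit R \<xi>"
  proof
    fix g assume "g \<in> E"
    then obtain v where v: "v \<in> lists B" "g = shift R (word_prod v) \<xi>" unfolding E_def by blast
    then have "word_prod v \<in> NI" using BN by (intro word_prod_nonzero) auto
    then show "g \<in> shift_orbit R \<xi>" using v(2) by (auto simp: shift_orbit_def)
  qed
  have "k I \<in> E \<rightarrow>\<^sub>E coefficients R \<xi>" if "I \<in> NI" for I
    unfolding k_def restrict_PiE_iff
  proof
    fix g assume "g \<in> E"
    then show "g I \<in> coefficients R \<xi>" by (rule PiE_mem[OF orbit[OF subsetD[OF E_orbit]] that])
  qed
  then have "k ` NI \<subseteq> E \<rightarrow>\<^sub>E coefficients R \<xi>" by (rule image_subsetI)
  then have "finite (k ` NI)"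
    by (rule finite_subset) (rule finite_PiE[OF E C])
  moreover note C
  moreover note orbit
  moreover have "g I = g J" if g: "g \<in> shift_orbit R \<xi>" and IJ: "I \<in> NI" "J \<in> NI" "k I = k J" for g I J
  proof -
    have eq: "\<xi> (word_prod v \<cdot>\<^bsub>R\<^esub> I) = \<xi> (word_prod v \<cdot>\<^bsub>R\<^esub> J)" if "v \<in> lists B" for v
    proof -
      have "shift R (word_prod v) \<xi> \<in> E" using that unfolding E_def by blast
      then have "shift R (word_prod v) \<xi> I = shift R (word_prod v) \<xi> J"
        using fun_cong[OF IJ(3), of "shift R (word_prod v) \<xi>"] by (simp add: k_def)
      then show ?thesis using IJ by (simp add: shift_apply)
    qed
    \<comment> \<open>Both words are needed: a bad prime in \<open>w\<close> is moved into
      \<open>v\<close>, next to \<open>I\<close>, where the keys decide; a good prime is peeled off,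
      since it preserves equality of two values.\<close>
    have "\<xi> (word_prod w \<cdot>\<^bsub>R\<^esub> (word_prod v \<cdot>\<^bsub>R\<^esub> I)) = \<xi> (word_prod w \<cdot>\<^bsub>R\<^esub> (word_prod v \<cdot>\<^bsub>R\<^esub> J))"
      if "w \<in> lists (nonzero_primes R)" "v \<in> lists B" for w v
      using that
    proof (induction w arbitrary: v rule: list.induct)
      case Nil
      have "word_prod v \<in> NI" using Nil BN by (intro word_prod_nonzero) auto
      then show ?case using eq[OF Nil(2)] IJ by (simp add: carrier_ideal_mult ideal_prod_nonzero)
    next
      case (Cons P w)
      have P: "P \<in> nonzero_primes R" "P \<in> NI" and w: "w \<in> lists (nonzero_primes R)" "word_prod w \<in> NI"
        and v: "word_prod v \<in> NI"
        using Cons.prems BN nonzero_prime_imp_ideal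
        by (auto intro!: word_prod_nonzero)
      note nz = ideal_prod_nonzero[OF v IJ(1)] ideal_prod_nonzero[OF v IJ(2)]
      have split: "word_prod (P # w) \<cdot>\<^bsub>R\<^esub> M = P \<cdot>\<^bsub>R\<^esub> (word_prod w \<cdot>\<^bsub>R\<^esub> M)" if "M \<in> NI" for M
        using ideal_mult_assoc[OF P(2) w(2) that] by simp
      show ?case
      proof (cases "P \<in> B")
        case True
        have swap: "word_prod (P # w) \<cdot>\<^bsub>R\<^esub> (word_prod v \<cdot>\<^bsub>R\<^esub> M)
            = word_prod w \<cdot>\<^bsub>R\<^esub> (word_prod (P # v) \<cdot>\<^bsub>R\<^esub> M)" if M: "M \<in> NI" for M
          using ideal_mult_commute[OF P(2) w(2)] ideal_mult_assoc[OF w(2) P(2) ideal_prod_nonzero[OF v M]]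
            ideal_mult_assoc[OF P(2) v M] by simp
        have "P # v \<in> lists B" using True Cons.prems(2) by simp
        then show ?thesis unfolding swap[OF IJ(1)] swap[OF IJ(2)] by (rule Cons.IH[OF w(1)])
      next
        case False
        then have "P \<in> nonzero_primes R - B" using P(1) by simp
        then show ?thesis
          unfolding split[OF nz(1)] split[OF nz(2)]
          by (rule good[OF _ ideal_prod_nonzero[OF w(2) nz(1)] ideal_prod_nonzero[OF w(2) nz(2)]
                Cons.IH[OF w(1) Cons.prems(2)]])
      qed
    qed
    from this[of _ "[]"] have words: "\<xi> (word_prod w \<cdot>\<^bsub>R\<^esub> I) = \<xi> (word_prod w \<cdot>\<^bsub>R\<^esub> J)"
      if "w \<in> lists (nonzero_primes R)" for w
      using that IJ(1,2) by (simp add: carrier_ideal_mult)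
    obtain M where M: "M \<in> NI" "g = shift R M \<xi>" using g unfolding shift_orbit_def by blast
    then obtain w where "w \<in> lists (nonzero_primes R)" "word_prod w = M"
      using prime_factorization by blast
    then show ?thesis using words[of w] M(2) IJ by (simp add: shift_apply)
  qed
  ultimately show ?thesis by (rule finite_functions_of_finite_key)
qed

end

section \<open>Integrality and automaticity\<close>

lemma ex_monic_int_poly_vanishing:
  assumes "finite C" "\<And>c. c \<in> C \<Longrightarrow> algebraic_int (c :: 'a::field_char_0)"
  shows "\<exists>p :: int poly. Polynomial.coeff p (Polynomial.degree p) = 1 \<and>
    (\<forall>c\<in>C. poly (map_poly of_int p) c = 0)"
  using assms
proof (induction C)
  case empty
  show ?case by (intro exI[of _ 1]) auto
next
  case (insert c C)
  then obtain p :: "int poly" where p: "Polynomial.coeff p (Polynomial.degree p) = 1"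
    "\<forall>c\<in>C. poly (map_poly of_int p) c = 0"
    by auto
  obtain q :: "int poly" where q: "Polynomial.coeff q (Polynomial.degree q) = 1"
    "poly (map_poly of_int q) c = 0"
    using insert.prems[of c] by (auto simp: algebraic_int_altdef_ipoly)
  have "Polynomial.coeff (q * p) (Polynomial.degree (q * p)) = 1"
    using p(1) q(1) Polynomial.lead_coeff_mult[of q p] by simp
  then show ?case
    using p(2) q(2) by (intro exI[of _ "q * p"]) (auto simp: of_int_poly_hom.hom_mult)
qed

context integers_extension
begin

lemma monic_combination_apply:
  assumes \<xi>: "\<xi> \<in> carrier G" and c: "\<And>i. i < n \<Longrightarrow> c i \<in> \<O>" and I: "I \<in> NI"
  shows "(\<xi> [^]\<^bsub>G\<^esub> (n::nat) \<oplus>\<^bsub>G\<^esub> (\<Oplus>\<^bsub>G\<^esub>i\<in>{..<n}. c i \<odot>\<^bsub>G\<^esub> (\<xi> [^]\<^bsub>G\<^esub> i))) I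
    = \<xi> I ^ n + (\<Sum>i<n. c i * \<xi> I ^ i)"
proof -
  interpret M: Module.module R G by (rule module_G)
  have "c i \<odot>\<^bsub>G\<^esub> (\<xi> [^]\<^bsub>G\<^esub> i) \<in> carrier G" if "i < n" for i
    using c[OF that] by (intro M.smult_closed G.nat_pow_closed \<xi>) simp
  then have "(\<Oplus>\<^bsub>G\<^esub>i\<in>{..<n}. c i \<odot>\<^bsub>G\<^esub> (\<xi> [^]\<^bsub>G\<^esub> i)) I = (\<Sum>i<n. (c i \<odot>\<^bsub>G\<^esub> (\<xi> [^]\<^bsub>G\<^esub> i)) I)"
    using I by (intro finsum_G) auto
  then show ?thesis using I by (simp add: pow_G[OF \<xi>])
qed

lemma finite_coefficients_if_integral:
  assumes \<xi>: "\<xi> \<in> carrier G" and int: "integral_over R G \<xi>"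
  shows "finite (coefficients R \<xi>)"
proof -
  obtain n :: nat and c where c: "\<And>i. i < n \<Longrightarrow> c i \<in> \<O>"
    and eq: "\<xi> [^]\<^bsub>G\<^esub> n \<oplus>\<^bsub>G\<^esub> (\<Oplus>\<^bsub>G\<^esub>i\<in>{..<n}. c i \<odot>\<^bsub>G\<^esub> (\<xi> [^]\<^bsub>G\<^esub> i)) = \<zero>\<^bsub>G\<^esub>"
    using int unfolding integral_over_def carrier_R by blast
  \<comment> \<open>The entry 1 at index \<open>n\<close> makes the polynomial monic, hence nonzero
    with finitely many roots.\<close>
  define d where "d i = (if i < n then c i else 1)" for i
  have "(\<Sum>i\<le>n. d i * \<xi> I ^ i) = 0" if I: "I \<in> NI" for I
  proof -
    have "\<xi> I ^ n + (\<Sum>i<n. c i * \<xi> I ^ i) = \<zero>\<^bsub>G\<^esub> I"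
      unfolding eq[symmetric] using monic_combination_apply[OF \<xi> c I] by simp
    then show ?thesis using I by (simp add: d_def add.commute flip: lessThan_Suc_atMost)
  qed
  then have "coefficients R \<xi> \<subseteq> {z. (\<Sum>i\<le>n. d i * z ^ i) = 0}"
    by (auto simp: coefficients_def)
  moreover have "finite {z. (\<Sum>i\<le>n. d i * z ^ i) = 0}"
  proof -
    define p where "p = (\<Sum>i\<le>n. Polynomial.monom (d i) i)"
    have "Polynomial.coeff p n = 1" by (simp add: p_def coeff_sum d_def)
    then have "p \<noteq> 0" by auto
    then show ?thesis using poly_roots_finite[of p] by (simp add: p_def poly_sum poly_monom)
  qed
  ultimately show ?thesis by (rule finite_subset)
qed

lemma integral_if_finite_coefficients:
  assumes \<xi>: "\<xi> \<in> carrier G" and C: "finite (coefficients R \<xi>)"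
  shows "integral_over R G \<xi>"
proof -
  interpret M: Module.module R G by (rule module_G)
  have "algebraic_int c" if "c \<in> coefficients R \<xi>" for c
    using coefficients_subset[OF \<xi>] that by (auto simp: int_ring_def)
  then obtain p :: "int poly" where p: "Polynomial.coeff p (Polynomial.degree p) = 1"
    "\<forall>c\<in>coefficients R \<xi>. poly (map_poly of_int p) c = 0"
    using ex_monic_int_poly_vanishing[OF C] by blast
  define n where "n = Polynomial.degree p"
  \<comment> \<open>Integer coefficients lie in every ring of integers, so an equation found for
    elements of \<open>L\<close> is one over that of \<open>K\<close>.\<close>
  define c :: "nat \<Rightarrow> 'a" where "c i = of_int (Polynomial.coeff p i)" for i
  have c: "c i \<in> \<O>" for i by (simp add: c_def int_ring_of_int)
  have "\<xi> [^]\<^bsub>G\<^esub> n \<oplus>\<^bsub>G\<^esub> (\<Oplus>\<^bsub>G\<^esub>i\<in>{..<n}. c i \<odot>\<^bsub>G\<^esub> (\<xi> [^]\<^bsub>G\<^esub> i)) = \<zero>\<^bsub>G\<^esub>" (is "?lhs = _")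
  proof (rule PiE_ext)
    have "?lhs \<in> carrier G"
      by (intro G.a_closed G.finsum_closed G.nat_pow_closed \<xi> Pi_I M.smult_closed) (simp add: c)
    then show "?lhs \<in> NI \<rightarrow>\<^sub>E \<O>L" unfolding ghost_simps(1) .
    show "\<zero>\<^bsub>G\<^esub> \<in> NI \<rightarrow>\<^sub>E \<O>L" using G.zero_closed unfolding ghost_simps(1) .
    fix I assume I: "I \<in> NI"
    have "\<xi> I ^ n + (\<Sum>i<n. c i * \<xi> I ^ i) = (\<Sum>i\<le>n. c i * \<xi> I ^ i)"
      using p(1) by (simp add: c_def n_def add.commute flip: lessThan_Suc_atMost)
    also have "\<dots> = poly (map_poly of_int p) (\<xi> I)"
      by (simp add: poly_altdef c_def n_def)
    also have "\<dots> = 0" using p(2) I by (auto simp: coefficients_def)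
    finally show "?lhs I = \<zero>\<^bsub>G\<^esub> I"
      using monic_combination_apply[OF \<xi> c I] I by simp
  qed
  then show ?thesis unfolding integral_over_def carrier_R using c by blast
qed

section \<open>Orbits and automata\<close>

lemma shift_carrier_ideal: "f \<in> carrier G \<Longrightarrow> shift R \<O> f = f"
  by (rule ext) (auto simp: shift_def carrier_ideal_mult PiE_iff extensional_def)

lemma shift_shift:
  assumes "I \<in> NI" "J \<in> NI"
  shows "shift R J (shift R I f) = shift R (I \<cdot>\<^bsub>R\<^esub> J) f"
  using assms by (auto simp: shift_def fun_eq_iff ideal_prod_nonzero ideal_mult_assoc)

text \<open>Evaluating the shift by \<open>I\<close> at the unit ideal recovers the coefficient at
  \<open>I\<close>.\<close>

lemma finite_coefficients_if_finite_orbit: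
  assumes "finite (shift_orbit R \<xi>)"
  shows "finite (coefficients R \<xi>)"
proof (rule finite_subset)
  show "coefficients R \<xi> \<subseteq> (\<lambda>g. g \<O>) ` shift_orbit R \<xi>"
  proof
    fix c assume "c \<in> coefficients R \<xi>"
    then obtain I where I: "I \<in> NI" "c = \<xi> I" unfolding coefficients_def by blast
    then have "c = shift R I \<xi> \<O>"
      by (simp add: shift_apply[OF carrier_nonzero_ideal] ideal_mult_carrier)
    then show "c \<in> (\<lambda>g. g \<O>) ` shift_orbit R \<xi>" using I(1) unfolding shift_orbit_def by blast
  qed
qed (use assms in simp)

text \<open>Every nonzero ideal is spelled by some prime word, so each coefficient is the output at
  some state.\<close>

lemma finite_coefficients_if_automatic:
  assumes "automatic R A \<xi>"
  shows "finite (coefficients R \<xi>)"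
proof -
  obtain S \<delta> s0 \<tau> where M: "dfao (nonzero_primes R) (carrier A) S \<delta> s0 \<tau>"
    and val: "\<And>w. w \<in> lists (nonzero_primes R) \<Longrightarrow> \<xi> (word_prod w) = \<tau> (foldl \<delta> s0 w)"
    using assms unfolding automatic_def by blast
  have S: "finite S" "s0 \<in> S" "\<And>s p. s \<in> S \<Longrightarrow> p \<in> nonzero_primes R \<Longrightarrow> \<delta> s p \<in> S"
    using M unfolding dfao_def by auto
  have run: "foldl \<delta> s w \<in> S" if "s \<in> S" "w \<in> lists (nonzero_primes R)" for s w
    using that by (induction w arbitrary: s rule: list.induct) (auto simp: S(3))
  have "\<xi> I \<in> \<tau> ` S" if I: "I \<in> NI" for I
  proof -
    obtain w where "w \<in> lists (nonzero_primes R)" "word_prod w = I"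
      using prime_factorization[OF I] by blast
    then show ?thesis using val[of w] run[OF S(2), of w] by auto
  qed
  then have "coefficients R \<xi> \<subseteq> \<tau> ` S" unfolding coefficients_def by blast
  then show ?thesis using S(1) finite_subset by blast
qed

text \<open>The orbit, numbered by \<open>h\<close>, serves as the state set with start \<xi>:
  reading a prime shifts, and the output evaluates at the unit ideal.\<close>

lemma automatic_if_finite_orbit:
  assumes \<xi>: "\<xi> \<in> carrier G" and fin: "finite (shift_orbit R \<xi>)"
  shows "automatic R A \<xi>"
proof -
  let ?Orb = "shift_orbit R \<xi>"
  obtain h :: "('a set \<Rightarrow> 'a) \<Rightarrow> nat" where h: "inj_on h ?Orb"
    using finite_imp_inj_to_nat_seg[OF fin] by blast
  define S where "S = h ` ?Orb"
  define g where "g = inv_into ?Orb h"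
  have gh: "g (h f) = f" if "f \<in> ?Orb" for f
    unfolding g_def by (rule inv_into_f_f[OF h that])
  define \<delta> where "\<delta> s P = h (shift R P (g s))" for s P
  define \<tau> where "\<tau> s = g s \<O>" for s
  have orb: "shift R I \<xi> \<in> ?Orb" if "I \<in> NI" for I
    using that unfolding shift_orbit_def by blast
  have orb_shift: "shift R P f \<in> ?Orb" if f: "f \<in> ?Orb" "P \<in> NI" for f P
  proof -
    obtain I where "I \<in> NI" "f = shift R I \<xi>" using f(1) unfolding shift_orbit_def by blast
    then show ?thesis using f(2) orb[OF ideal_prod_nonzero] by (simp add: shift_shift)
  qed
  have \<xi>_orb: "\<xi> \<in> ?Orb" using orb[OF carrier_nonzero_ideal] shift_carrier_ideal[OF \<xi>] by simp
  have run: "foldl \<delta> (h \<xi>) w = h (shift R (word_prod w) \<xi>)" if "w \<in> lists (nonzero_primes R)" for w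
    using that
  proof (induction w rule: rev_induct)
    case Nil
    then show ?case by (simp add: shift_carrier_ideal[OF \<xi>])
  next
    case (snoc P w)
    have w: "w \<in> lists NI" "P \<in> NI" using snoc.prems nonzero_prime_imp_ideal by auto
    then have W: "word_prod w \<in> NI" using word_prod_nonzero by blast
    have "foldl \<delta> (h \<xi>) (w @ [P]) = \<delta> (h (shift R (word_prod w) \<xi>)) P"
      using snoc by simp
    also have "\<dots> = h (shift R P (shift R (word_prod w) \<xi>))"
      by (simp add: \<delta>_def gh orb W)
    also have "shift R P (shift R (word_prod w) \<xi>) = shift R (word_prod (w @ [P])) \<xi>"
      using w W word_prod_append[of w "[P]"] by (simp add: shift_shift ideal_mult_carrier)
    finally show ?case .
  qed
  have "\<xi> (word_prod w) = \<tau> (foldl \<delta> (h \<xi>) w)" if w: "w \<in> lists (nonzero_primes R)" for w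
  proof -
    have W: "word_prod w \<in> NI" using w prime_words_ideal_words word_prod_nonzero by blast
    then show ?thesis
      unfolding \<tau>_def run[OF w] gh[OF orb[OF W]]
      by (simp add: shift_apply[OF carrier_nonzero_ideal] ideal_mult_carrier)
  qed
  moreover have "dfao (nonzero_primes R) (carrier A) S \<delta> (h \<xi>) \<tau>"
    unfolding dfao_def
  proof (intro conjI ballI)
    show "finite S" "h \<xi> \<in> S" using fin \<xi>_orb by (auto simp: S_def)
  next
    fix s P assume "s \<in> S" "P \<in> nonzero_primes R"
    then show "\<delta> s P \<in> S"
      using orb_shift nonzero_prime_imp_ideal by (auto simp: S_def \<delta>_def gh)
  next
    fix s assume "s \<in> S"
    then obtain I where I: "I \<in> NI" "s = h (shift R I \<xi>)" unfolding S_def shift_orbit_def by blast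
    then have "\<tau> s = \<xi> I"
      by (simp add: \<tau>_def gh orb shift_apply[OF carrier_nonzero_ideal] ideal_mult_carrier)
    moreover have "\<xi> I \<in> \<O>L" using \<xi> I(1) by (auto simp: PiE_iff)
    ultimately show "\<tau> s \<in> carrier A" by (simp add: algebra_of_integers_def int_ring_def)
  qed
  ultimately show ?thesis unfolding automatic_def by blast
qed

end

theorem mainTheorem7:
  fixes K L :: "'a::field_char_0 set" and \<xi> :: "'a set \<Rightarrow> 'a"
  assumes "finite_extension_of_number_fields K L"
    and "\<xi> \<in> witt_vectors (ring_of_integers K) (algebra_of_integers L)"
  shows "(integral_over (ring_of_integers K)
            (ghost_algebra (ring_of_integers K) (algebra_of_integers L)) \<xi>
          \<longleftrightarrow> finite (coefficients (ring_of_integers K) \<xi>))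
       \<and> (finite (coefficients (ring_of_integers K) \<xi>)
          \<longleftrightarrow> finite (shift_orbit (ring_of_integers K) \<xi>))
       \<and> (finite (shift_orbit (ring_of_integers K) \<xi>)
          \<longleftrightarrow> automatic (ring_of_integers K) (algebra_of_integers L) \<xi>)"
proof -
  interpret integers_extension K L
    using assms(1) unfolding finite_extension_of_number_fields_def by unfold_locales auto
  have \<xi>: "\<xi> \<in> carrier G"
    using assms(2) witt_stage_carrier[of 0] unfolding witt_vectors_def by blast
  \<comment> \<open>Finiteness of the coefficients is the hub: it is equivalent to integrality and
    to a finite orbit, while automaticity follows from the latter and implies the hub.\<close>
  show ?thesis
    using finite_coefficients_if_integral[OF \<xi>] integral_if_finite_coefficients[OF \<xi>]
      finite_orbit_if_finite_coefficients[OF assms(2)] finite_coefficients_if_finite_orbit[of \<xi>]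
      automatic_if_finite_orbit[OF \<xi>] finite_coefficients_if_automatic[of \<xi>]
    by blast
qed

end
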